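(* For integers $a,b\geq 1$ with $a+b\geq 3$, the graph $\mathcal{F}_{(a,b)}$ is isomorphic to the flip graph of $(a-1,b-1)$-combinations under adjacent transpositions. Consequently, $\mathcal{F}_{(a,b)}$ has a Hamilton path if and only if $a\in\{1,2\}$, or $b\in\{1,2\}$, or $a$ and $b$ are both even. Furthermore, if $a,b\geq 2$, then $\mathcal{F}_{(a,b)}$ has no Hamilton cycle.
   Context: Let $N=a+b$ and label the points of a convex $N$-gon $1,\ldots,N$ counterclockwise; color the first $a$ points red and the remaining $b$ points blue. The associahedron $\mathcal{G}_N$ has as nodes all triangulations of the convex $N$-gon, two adjacent if they differ in a flip (removing a diagonal shared by two triangles and replacing it by the other diagonal of the resulting quadrilateral). A triangulation is colorful if no triangle has all three points of the same color; $\mathcal{F}_{(a,b)}$ is the subgraph of $\mathcal{G}_N$ induced by the colorful triangulations. An $(a-1,b-1)$-combination is a bitstring of length $N-2$ with exactly $a-1$ zeros and $b-1$ ones; the flip graph of these under adjacent transpositions has an edge between two such bitstrings if one arises from the other by swapping two adjacent (distinct) bits. *)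

theory Defs
  imports "Graph_Theory.Graph_Theory"
begin

section \<open>Triangulations of a convex polygon\<close>

text \<open>
  The points of the convex \<open>N\<close>-gon are the numbers \<open>1, \<dots>, N\<close> in counterclockwise order, a segment
  between two points is the set of its endpoints, and a triangulation is given by its set of
  diagonals.
\<close>

definition polygon_sides :: "nat \<Rightarrow> nat set set" where
  "polygon_sides N = {{i, Suc i} | i. 1 \<le> i \<and> i < N} \<union> {{N, 1}}"

definition diagonals :: "nat \<Rightarrow> nat set set" where
  "diagonals N = {{i, j} | i j. i \<in> {1..N} \<and> j \<in> {1..N} \<and> i \<noteq> j} - polygon_sides N"

text \<open>
  Two segments between points in convex position meet in their relative interiors without
  overlapping if and only if their endpoints are four distinct points that alternate along the
  boundary.
\<close>

definition crossing :: "nat set \<Rightarrow> nat set \<Rightarrow> bool" where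
  "crossing e f \<longleftrightarrow> (\<exists>i j k l. i < j \<and> j < k \<and> k < l \<and> {e, f} = {{i, k}, {j, l}})"

definition triangulation :: "nat \<Rightarrow> nat set set \<Rightarrow> bool" where
  "triangulation N T \<longleftrightarrow>
     T \<subseteq> diagonals N \<and>
     (\<forall>e\<in>T. \<forall>f\<in>T. \<not> crossing e f) \<and>
     (\<forall>d\<in>diagonals N - T. \<exists>e\<in>T. crossing d e)"

text \<open>
  As there are no points inside the polygon, any three points that are pairwise joined by a side
  or by a diagonal of \<open>T\<close> bound a triangular face.
\<close>

definition triangles :: "nat \<Rightarrow> nat set set \<Rightarrow> nat set set" where
  "triangles N T = {{p, q, r} | p q r. p \<noteq> q \<and> q \<noteq> r \<and> p \<noteq> r \<and>
     {{p, q}, {q, r}, {p, r}} \<subseteq> polygon_sides N \<union> T}"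

text \<open>
  The triangles \<open>pqr\<close> and \<open>pqs\<close> lie on different sides of their common diagonal \<open>pq\<close>, so \<open>rs\<close> is
  the other diagonal of the quadrilateral \<open>prqs\<close>.
\<close>

definition flip :: "nat \<Rightarrow> nat set set \<Rightarrow> nat set set \<Rightarrow> bool" where
  "flip N T T' \<longleftrightarrow> (\<exists>p q r s. {p, q} \<in> T \<and> r \<noteq> s \<and>
     {p, q, r} \<in> triangles N T \<and> {p, q, s} \<in> triangles N T \<and>
     T' = (T - {{p, q}}) \<union> {{r, s}})"

text \<open>
  Undirected graphs are represented by digraphs with a symmetric set of arcs.
\<close>

definition associahedron :: "nat \<Rightarrow> (nat set set, nat set set \<times> nat set set) pre_digraph" where
  "associahedron N = with_proj
     \<lparr> pverts = {T. triangulation N T},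
       parcs = {(T, T'). triangulation N T \<and> triangulation N T' \<and> flip N T T'} \<rparr>"


section \<open>Colorful triangulations\<close>

definition red_points :: "nat \<Rightarrow> nat \<Rightarrow> nat set" where
  "red_points a b = {1..a}"

definition blue_points :: "nat \<Rightarrow> nat \<Rightarrow> nat set" where
  "blue_points a b = {a + 1..a + b}"

definition colorful :: "nat \<Rightarrow> nat \<Rightarrow> nat set set \<Rightarrow> bool" where
  "colorful a b T \<longleftrightarrow>
     (\<forall>t\<in>triangles (a + b) T. \<not> t \<subseteq> red_points a b \<and> \<not> t \<subseteq> blue_points a b)"

definition colorful_flip_graph ::
    "nat \<Rightarrow> nat \<Rightarrow> (nat set set, nat set set \<times> nat set set) pre_digraph" where
  "colorful_flip_graph a b =
     associahedron (a + b) \<restriction> {T \<in> verts (associahedron (a + b)). colorful a b T}"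


section \<open>Combinations under adjacent transpositions\<close>

text \<open>The bit 0 is \<^const>\<open>False\<close>, the bit 1 is \<^const>\<open>True\<close>.\<close>

definition combinations :: "nat \<Rightarrow> nat \<Rightarrow> bool list set" where
  "combinations k l =
     {w. length w = k + l \<and> count_list w False = k \<and> count_list w True = l}"

definition adjacent_transposition :: "bool list \<Rightarrow> bool list \<Rightarrow> bool" where
  "adjacent_transposition v w \<longleftrightarrow>
     (\<exists>i. Suc i < length v \<and> v ! i \<noteq> v ! Suc i \<and> w = v[i := v ! Suc i, Suc i := v ! i])"

definition combination_graph ::
    "nat \<Rightarrow> nat \<Rightarrow> (bool list, bool list \<times> bool list) pre_digraph" where
  "combination_graph k l = with_proj
     \<lparr> pverts = combinations k l,
       parcs = {(v, w). v \<in> combinations k l \<and> w \<in> combinations k l \<and>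
                        adjacent_transposition v w} \<rparr>"


section \<open>Hamilton paths and cycles\<close>

definition has_hamilton_path :: "('a, 'b) pre_digraph \<Rightarrow> bool" where
  "has_hamilton_path G \<longleftrightarrow> (\<exists>p. vpath p G \<and> set p = verts G)"

text \<open>
  A cycle in an undirected graph has at least three vertices; in particular, traversing a single
  edge back and forth does not count as a cycle.
\<close>

definition has_hamilton_cycle :: "('a, 'b) pre_digraph \<Rightarrow> bool" where
  "has_hamilton_cycle G \<longleftrightarrow>
     (\<exists>p. vpath p G \<and> set p = verts G \<and> 3 \<le> length p \<and> (last p, hd p) \<in> arcs_ends G)"

end

theory Submission
  imports Defs "HOL-Library.Product_Order"
begin

text \<open>
  A colorful triangulation has no diagonal between points of the same color, since the triangle on
  its monochromatic side would be monochromatic. The segments between a red and a blue point form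
  an \<open>a \<times> b\<close> grid in which non-crossing means comparable, so colorful triangulations are the maximal
  chains of the grid, i.e. lattice paths with \<open>a - 1\<close> and \<open>b - 1\<close> steps of the two kinds, and a flip
  exchanges two consecutive distinct steps.

  Write \<open>C(k,l)\<close> for the graph of combinations. The sign of a word is \<open>-1\<close> to the number of its
  inversions. Adjacent words have opposite signs, so the sum of the signs along a Hamilton path is at
  most 1 in absolute value. The sum over \<open>C(k,l)\<close> is the Gaussian binomial coefficient at \<open>q = -1\<close>,
  which is at least 2 if \<open>k, l \<ge> 2\<close> are not both odd.
  For \<open>k, l\<close> both odd a Hamilton path from \<open>0\<^sup>k1\<^sup>l\<close> to \<open>1\<^sup>l0\<^sup>k\<close> runs through the words that start
  with \<open>00\<close>, then through those that start with \<open>01\<close> or \<open>10\<close>, and then through those that start with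
  \<open>11\<close>. The middle part is the prism over \<open>C(k-1,l-1)\<close>, where both parameters are even; its
  Hamilton paths are constructed by splitting off two further bits. There is no Hamilton cycle
  because \<open>0\<^sup>k1\<^sup>l\<close> has degree at most 1.
\<close>


section \<open>Hamilton paths and cycles of a relation\<close>

inductive ham_path :: "('a \<Rightarrow> 'a \<Rightarrow> bool) \<Rightarrow> 'a set \<Rightarrow> 'a \<Rightarrow> 'a \<Rightarrow> bool" for R where
  ham_path_singleton: "ham_path R {x} x x"
| ham_path_insert: "R x y \<Longrightarrow> ham_path R S y z \<Longrightarrow> x \<notin> S \<Longrightarrow> ham_path R (insert x S) x z"

definition ham_cycle :: "('a \<Rightarrow> 'a \<Rightarrow> bool) \<Rightarrow> 'a set \<Rightarrow> bool" where
  "ham_cycle R S \<longleftrightarrow> 3 \<le> card S \<and> (\<exists>x y. ham_path R S x y \<and> R y x)"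

lemma finite_if_ham_path: "ham_path R S x y \<Longrightarrow> finite S"
  by (induction rule: ham_path.induct) auto

lemma ham_path_source_in: "ham_path R S x y \<Longrightarrow> x \<in> S"
  by (auto elim: ham_path.cases)

lemma ham_path_target_in: "ham_path R S x y \<Longrightarrow> y \<in> S"
  by (induction rule: ham_path.induct) auto

lemma ham_path_append:
  assumes "ham_path R S x y" and "R y x'" and "ham_path R S' x' y'" and "S \<inter> S' = {}"
  shows "ham_path R (S \<union> S') x y'"
  using assms
proof (induction rule: ham_path.induct)
  case (ham_path_singleton x)
  then show ?case
    using ham_path.ham_path_insert by fastforce
next
  case (ham_path_insert x u S y)
  then have "ham_path R (insert x (S \<union> S')) x y'"
    by (intro ham_path.ham_path_insert[where y = u]) auto
  then show ?case by simp
qed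

lemma ham_path_snoc:
  "ham_path R S x y \<Longrightarrow> R y z \<Longrightarrow> z \<notin> S \<Longrightarrow> ham_path R (insert z S) x z"
  using ham_path_append[OF _ _ ham_path_singleton, of R S x y z] by simp

lemma ham_path_rev:
  assumes "symp R" and "ham_path R S x y"
  shows "ham_path R S y x"
  using assms(2)
  by induction (use \<open>symp R\<close> in \<open>auto intro: ham_path_singleton ham_path_snoc dest: sympD\<close>)

lemma ham_path_image:
  assumes "ham_path R S x y" and "inj_on f S"
    and "\<And>u v. u \<in> S \<Longrightarrow> v \<in> S \<Longrightarrow> R u v \<Longrightarrow> R' (f u) (f v)"
  shows "ham_path R' (f ` S) (f x) (f y)"
  using assms
proof (induction rule: ham_path.induct)
  case (ham_path_singleton x)
  show ?case by (simp add: ham_path.ham_path_singleton)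
next
  case (ham_path_insert x y S z)
  have "R' (f x) (f y)"
    using ham_path_insert ham_path_source_in by (metis insertCI)
  moreover have "f x \<notin> f ` S"
    using ham_path_insert.hyps(3) ham_path_insert.prems(1) by (simp add: inj_on_insert)
  ultimately show ?case
    using ham_path_insert by (simp add: ham_path.ham_path_insert)
qed

lemma ham_path_splitE:
  assumes "ham_path R S x y" and "v \<in> S" and "v \<noteq> x"
  obtains A B u where "S = A \<union> B" and "A \<inter> B = {}"
    and "ham_path R A x u" and "R u v" and "ham_path R B v y"
proof -
  have "\<exists>A B u. S = A \<union> B \<and> A \<inter> B = {} \<and> ham_path R A x u \<and> R u v \<and> ham_path R B v y"
    using assms
  proof (induction rule: ham_path.induct)
    case (ham_path_insert x x' S y)
    show ?case
    proof (cases "v = x'")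
      case True
      then show ?thesis
        using ham_path_insert ham_path_singleton[of R x]
        by (intro exI[of _ "{x}"] exI[of _ S] exI[of _ x]) auto
    next
      case False
      then obtain A B u where "S = A \<union> B" "A \<inter> B = {}"
        "ham_path R A x' u" "R u v" "ham_path R B v y"
        using ham_path_insert by auto
      then show ?thesis
        using ham_path_insert.hyps ham_path.ham_path_insert[of R x x' A u]
        by (intro exI[of _ "insert x A"] exI[of _ B] exI[of _ u]) auto
    qed
  qed auto
  then show thesis using that by blast
qed

lemma ham_cycle_path_from:
  assumes "ham_cycle R S" and "v \<in> S"
  obtains u where "ham_path R S v u" and "R u v"
proof -
  obtain x y where xy: "ham_path R S x y" "R y x"
    using assms(1) unfolding ham_cycle_def by blast
  show thesis
  proof (cases "v = x")
    case False
    obtain A B u where "S = A \<union> B" "A \<inter> B = {}" "ham_path R A x u" "R u v" "ham_path R B v y"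
      by (rule ham_path_splitE[OF xy(1) assms(2) False])
    then show thesis
      using that[of u] ham_path_append[of R B v y x A u] xy(2) by (simp add: Un_commute Int_commute)
  qed (use xy that in blast)
qed

lemma ham_cycle_two_neighbours:
  assumes "symp R" and "ham_cycle R S" and "v \<in> S"
  obtains m n where "m \<noteq> n" and "R v m" and "R v n" and "ham_path R S v m" and "ham_path R S v n"
proof -
  obtain n where n: "ham_path R S v n" "R n v"
    using ham_cycle_path_from[OF assms(2,3)] by blast
  have "3 \<le> card S"
    using assms(2) by (simp add: ham_cycle_def)
  with n(1) obtain m A where m: "S = insert v A" "R v m" "ham_path R A m n" "v \<notin> A"
    by cases auto
  have "m \<noteq> n"
  proof
    assume "m = n"
    from m(3)[folded this] have "A = {m}"
      by cases (auto dest: ham_path_target_in)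
    with m(1) \<open>3 \<le> card S\<close> show False
      by (simp add: card_insert_if split: if_splits)
  qed
  moreover have "ham_path R S v m"
    using ham_path_rev[OF assms(1)] ham_path_snoc[OF m(3) n(2) m(4)] m(1) by blast
  ultimately show thesis
    using that n m(2) assms(1) by (blast dest: sympD)
qed


section \<open>Hamilton paths of prisms\<close>

definition prism :: "('a \<Rightarrow> 'a \<Rightarrow> bool) \<Rightarrow> bool \<times> 'a \<Rightarrow> bool \<times> 'a \<Rightarrow> bool" where
  "prism R p q \<longleftrightarrow> (if fst p = fst q then R (snd p) (snd q) else snd p = snd q)"

definition rung_path :: "('a \<Rightarrow> 'a \<Rightarrow> bool) \<Rightarrow> 'a set \<Rightarrow> 'a \<Rightarrow> bool" where
  "rung_path R S v \<longleftrightarrow> ham_path (prism R) (UNIV \<times> S) (True, v) (False, v)"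

lemma prism_Pair [simp]: "prism R (c, u) (d, v) \<longleftrightarrow> (if c = d then R u v else u = v)"
  by (simp add: prism_def)

lemma symp_prism: "symp R \<Longrightarrow> symp (prism R)"
  by (auto simp: symp_def)

lemma rung_pathD:
  assumes "symp R" and "rung_path R S v"
  shows "ham_path (prism R) (UNIV \<times> S) (c, v) (\<not> c, v)"
  using assms(2) ham_path_rev[OF symp_prism[OF assms(1)]]
  unfolding rung_path_def by (cases c) auto

lemma rung_path_singleton: "rung_path R {v} v"
proof -
  have "ham_path (prism R) {(True, v), (False, v)} (True, v) (False, v)"
    by (intro ham_path_insert[OF _ ham_path_singleton]) auto
  moreover have "UNIV \<times> {v} = {(True, v), (False, v)}"
    by (auto simp: UNIV_bool)
  ultimately show ?thesis
    unfolding rung_path_def by simp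
qed

lemma rung_path_insert:
  assumes "symp R" and "R u v" and "rung_path R S v" and "u \<notin> S"
  shows "rung_path R (insert u S) u"
proof -
  have "ham_path (prism R) (insert (True, u) (UNIV \<times> S)) (True, u) (False, v)"
    using assms unfolding rung_path_def by (intro ham_path_insert) auto
  then have "ham_path (prism R) (insert (False, u) (insert (True, u) (UNIV \<times> S)))
      (True, u) (False, u)"
    using assms sympD by (intro ham_path_snoc) fastforce+
  moreover have "insert (False, u) (insert (True, u) (UNIV \<times> S)) = UNIV \<times> insert u S"
    by (auto simp: UNIV_bool)
  ultimately show ?thesis
    unfolding rung_path_def by simp
qed

lemma rung_path_image:
  assumes "rung_path R S v" and "inj_on f S"
    and "\<And>u v. u \<in> S \<Longrightarrow> v \<in> S \<Longrightarrow> R u v \<Longrightarrow> R' (f u) (f v)"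
  shows "rung_path R' (f ` S) (f v)"
proof -
  have "ham_path (prism R') (apsnd f ` (UNIV \<times> S)) (apsnd f (True, v)) (apsnd f (False, v))"
    using assms(1) unfolding rung_path_def
    by (rule ham_path_image) (use assms(2,3) in \<open>auto simp: inj_on_def split: if_splits\<close>)
  moreover have "apsnd f ` ((UNIV :: bool set) \<times> S) = UNIV \<times> f ` S"
    by force
  ultimately show ?thesis
    unfolding rung_path_def by simp
qed

lemma ham_path_imp_rung_path:
  assumes "symp R" and "ham_path R S x y"
  shows "rung_path R S x"
  using assms(2) by induction (use \<open>symp R\<close> in \<open>auto intro: rung_path_singleton rung_path_insert\<close>)

lemma ham_cycle_imp_rung_path:
  assumes "symp R" and "ham_cycle (prism R) (UNIV \<times> S)" and "v \<in> S"
    and unique: "\<And>u. R v u \<Longrightarrow> u = w"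
  shows "rung_path R S v"
proof -
  have neighbour: "q = (False, v) \<or> q = (True, w)" if "prism R (True, v) q" for q
    using that unique by (cases q) (auto split: if_splits)
  obtain m n where "m \<noteq> n" "prism R (True, v) m" "prism R (True, v) n"
    "ham_path (prism R) (UNIV \<times> S) (True, v) m" "ham_path (prism R) (UNIV \<times> S) (True, v) n"
    using ham_cycle_two_neighbours[OF symp_prism[OF assms(1)] assms(2), of "(True, v)"] assms(3)
    by blast
  then show ?thesis
    unfolding rung_path_def using neighbour by metis
qed

text \<open>Consecutive rungs of a prism are traversed in opposite directions.\<close>

lemma ham_path_prism_zigzag:
  assumes "symp R" and "ham_path R S x y" and "\<And>v. v \<in> S \<Longrightarrow> rung_path R (K v) v"
    and "disjoint_family_on K S"
  shows "ham_path (prism R) (UNIV \<times> (\<Union>v\<in>S. K v)) (c, x) (c \<longleftrightarrow> even (card S), y)"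
  using assms(2-)
proof (induction arbitrary: c rule: ham_path.induct)
  case (ham_path_singleton x)
  then show ?case using rung_pathD[OF \<open>symp R\<close>] by simp
next
  case (ham_path_insert x x' S y)
  have "ham_path (prism R) (UNIV \<times> (\<Union>v\<in>S. K v)) (\<not> c, x') ((\<not> c) \<longleftrightarrow> even (card S), y)"
    using ham_path_insert.prems by (intro ham_path_insert.IH) (auto simp: disjoint_family_on_def)
  moreover have "ham_path (prism R) (UNIV \<times> K x) (c, x) (\<not> c, x)"
    using ham_path_insert.prems(1) by (intro rung_pathD[OF \<open>symp R\<close>]) simp
  moreover have "K x \<inter> (\<Union>v\<in>S. K v) = {}"
    using ham_path_insert.prems(2) ham_path_insert.hyps(3) by (auto simp: disjoint_family_on_def)
  ultimately have "ham_path (prism R) (UNIV \<times> K x \<union> UNIV \<times> (\<Union>v\<in>S. K v)) (c, x)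
      ((\<not> c) \<longleftrightarrow> even (card S), y)"
    using ham_path_insert.hyps(1) by (intro ham_path_append) auto
  moreover have "card (insert x S) = Suc (card S)"
    using ham_path_insert.hyps finite_if_ham_path by (metis card_insert_disjoint)
  ultimately show ?case
    by (cases c) (simp_all add: Sigma_Un_distrib2)
qed


section \<open>Words and adjacent transpositions\<close>

abbreviation (input) "adj \<equiv> adjacent_transposition"

definition bottom_word :: "nat \<Rightarrow> nat \<Rightarrow> bool list" where
  "bottom_word k l = replicate k False @ replicate l True"

definition top_word :: "nat \<Rightarrow> nat \<Rightarrow> bool list" where
  "top_word k l = replicate l True @ replicate k False"

lemma bottom_word_Suc_left: "bottom_word (Suc k) l = False # bottom_word k l"
  by (simp add: bottom_word_def)

lemma top_word_Suc_right: "top_word k (Suc l) = True # top_word k l"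
  by (simp add: top_word_def)

lemma map_Not_bottom_word: "map Not (bottom_word k l) = top_word l k"
  by (simp add: bottom_word_def top_word_def)

lemma map_Not_top_word: "map Not (top_word k l) = bottom_word l k"
  by (simp add: bottom_word_def top_word_def)

lemma adj_iff_append:
  "adj v w \<longleftrightarrow> (\<exists>x c y. v = x @ c # (\<not> c) # y \<and> w = x @ (\<not> c) # c # y)"
proof
  assume "adj v w"
  then obtain i where i: "Suc i < length v" "v ! i \<noteq> v ! Suc i"
    and w: "w = v[i := v ! Suc i, Suc i := v ! i]"
    unfolding adjacent_transposition_def by blast
  define x c y where "x = take i v" and "c = v ! i" and "y = drop (Suc (Suc i)) v"
  have bits: "v ! i = c" "v ! Suc i = (\<not> c)"
    using i(2) by (auto simp: c_def)
  have "v = take i v @ v ! i # v ! Suc i # drop (Suc (Suc i)) v"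
    using i(1) by (metis Cons_nth_drop_Suc Suc_lessD append_take_drop_id)
  then have v: "v = x @ c # (\<not> c) # y"
    by (simp only: bits x_def[symmetric] y_def[symmetric])
  moreover have "length x = i"
    using i(1) by (simp add: x_def)
  then have "w = x @ (\<not> c) # c # y"
    unfolding w bits by (simp add: v list_update_append)
  ultimately show "\<exists>x c y. v = x @ c # (\<not> c) # y \<and> w = x @ (\<not> c) # c # y"
    by blast
next
  assume "\<exists>x c y. v = x @ c # (\<not> c) # y \<and> w = x @ (\<not> c) # c # y"
  then obtain x c y where "v = x @ c # (\<not> c) # y" "w = x @ (\<not> c) # c # y" by blast
  then show "adj v w"
    unfolding adjacent_transposition_def
    by (intro exI[of _ "length x"]) (simp add: nth_append list_update_append)
qed

lemma adj_Cons:
  "adj (c # v) (d # w) \<longleftrightarrow> (if c = d then adj v w else \<exists>z. v = d # z \<and> w = c # z)"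
  (is "_ \<longleftrightarrow> ?rhs")
proof
  assume "adj (c # v) (d # w)"
  then obtain x b y where "c # v = x @ b # (\<not> b) # y" "d # w = x @ (\<not> b) # b # y"
    unfolding adj_iff_append by blast
  then show ?rhs
    by (cases x) (auto simp: adj_iff_append)
next
  assume ?rhs
  show "adj (c # v) (d # w)"
  proof (cases "c = d")
    case True
    with \<open>?rhs\<close> obtain x b y where "v = x @ b # (\<not> b) # y" "w = x @ (\<not> b) # b # y"
      unfolding adj_iff_append by auto
    with True show ?thesis
      unfolding adj_iff_append by (intro exI[of _ "c # x"]) auto
  next
    case False
    with \<open>?rhs\<close> show ?thesis
      unfolding adj_iff_append by (intro exI[of _ "[]"]) auto
  qed
qed

lemma symp_adj: "symp adj"
proof (rule sympI)
  fix v w assume "adj v w"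
  then obtain x c y where "v = x @ c # (\<not> c) # y" "w = x @ (\<not> c) # c # y"
    unfolding adj_iff_append by blast
  then show "adj w v"
    unfolding adj_iff_append by (intro exI[of _ x] exI[of _ "\<not> c"] exI[of _ y]) simp
qed

lemma adj_map_Not: "adj v w \<Longrightarrow> adj (map Not v) (map Not w)"
  unfolding adj_iff_append by (metis (no_types, lifting) list.simps(9) map_append)

lemma adj_bottom_word:
  assumes "adj (bottom_word k l) w"
  shows "w = (bottom_word k l)[k - 1 := True, k := False]"
proof -
  have "length (bottom_word k l) = k + l"
    by (simp add: bottom_word_def)
  with assms obtain i where i: "Suc i < k + l" "bottom_word k l ! i \<noteq> bottom_word k l ! Suc i"
    and w: "w = (bottom_word k l)[i := bottom_word k l ! Suc i, Suc i := bottom_word k l ! i]"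
    unfolding adjacent_transposition_def by metis
  have "bottom_word k l ! j \<longleftrightarrow> k \<le> j" if "j < k + l" for j
    using that by (auto simp: bottom_word_def nth_append)
  with i w show ?thesis
    by (cases "Suc i = k") auto
qed


section \<open>Combinations\<close>

lemma in_combinations_iff:
  "w \<in> combinations k l \<longleftrightarrow> count_list w False = k \<and> count_list w True = l"
proof -
  have "length w = count_list w False + count_list w True"
    by (induction w) auto
  then show ?thesis by (auto simp: combinations_def)
qed

lemma Cons_in_combinations_iff:
  "c # w \<in> combinations k l \<longleftrightarrow>
     (if c then 0 < l \<and> w \<in> combinations k (l - 1) else 0 < k \<and> w \<in> combinations (k - 1) l)"
  by (auto simp: in_combinations_iff)

lemma count_list_replicate: "count_list (replicate n x) y = (if x = y then n else 0)"
  by (induction n) auto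

lemma bottom_word_in_combinations: "bottom_word k l \<in> combinations k l"
  by (simp add: bottom_word_def in_combinations_iff count_list_replicate)

lemma top_word_in_combinations: "top_word k l \<in> combinations k l"
  by (simp add: top_word_def in_combinations_iff count_list_replicate)

lemma finite_combinations: "finite (combinations k l)"
  by (rule finite_subset[OF _ finite_lists_length_eq[of UNIV "k + l"]])
    (auto simp: combinations_def)

lemma map_Not_combinations: "map Not ` combinations k l = combinations l k"
proof -
  have "count_list (map Not w) c = count_list w (\<not> c)" for w c
    by (induction w) auto
  then have "map Not w \<in> combinations l k \<longleftrightarrow> w \<in> combinations k l" for w k l
    by (auto simp: in_combinations_iff)
  moreover have "w = map Not (map Not w)" for w
    by (simp add: comp_def)
  ultimately show ?thesis by (blast intro: image_eqI)
qed

lemma combinations_0_left: "combinations 0 l = {bottom_word 0 l}"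
proof -
  have "w = bottom_word 0 l" if "w \<in> combinations 0 l" for w
    using that unfolding bottom_word_def by (induction w arbitrary: l)
      (auto simp: Cons_in_combinations_iff in_combinations_iff Cons_replicate_eq split: if_splits)
  then show ?thesis using bottom_word_in_combinations by blast
qed

lemma combinations_0_right: "combinations k 0 = {top_word k 0}"
proof -
  have "combinations k 0 = map Not ` combinations 0 k"
    by (rule map_Not_combinations[symmetric])
  then show ?thesis by (simp add: combinations_0_left map_Not_bottom_word)
qed

lemma combinations_Suc_Suc:
  "combinations (Suc k) (Suc l) =
     (#) False ` combinations k (Suc l) \<union> (#) True ` combinations (Suc k) l"
proof (rule set_eqI)
  fix w show "w \<in> combinations (Suc k) (Suc l) \<longleftrightarrow>
    w \<in> (#) False ` combinations k (Suc l) \<union> (#) True ` combinations (Suc k) l"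
    by (cases w; cases "hd w") (auto simp: in_combinations_iff)
qed


section \<open>Sum of signs\<close>

fun inversion_sign :: "bool list \<Rightarrow> int" where
  "inversion_sign [] = 1"
| "inversion_sign (c # w) = (if c then (-1) ^ count_list w False else 1) * inversion_sign w"

lemma inversion_sign_adj:
  assumes "adj v w"
  shows "inversion_sign w = - inversion_sign v"
proof -
  have "inversion_sign (x @ True # False # y) = - inversion_sign (x @ False # True # y)" for x y
    by (induction x) auto
  then show ?thesis
    using assms unfolding adj_iff_append by (metis (full_types) add.inverse_inverse)
qed

lemma abs_inversion_sign: "\<bar>inversion_sign w\<bar> = 1"
  by (induction w) (auto simp: abs_mult power_abs)

text \<open>The Gaussian binomial coefficient at \<open>q = -1\<close>.\<close>

lemma sum_inversion_sign_combinations: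
  "sum inversion_sign (combinations k l) =
     (if odd k \<and> odd l then 0 else int ((k div 2 + l div 2) choose (k div 2)))"
proof (induction "k + l" arbitrary: k l)
  case 0
  then show ?case by (simp add: combinations_0_left bottom_word_def)
next
  case (Suc n)
  have sign_replicate: "inversion_sign (replicate m c) = 1" for m c
    by (induction m) (auto simp: count_list_replicate)
  show ?case
  proof (cases "k = 0 \<or> l = 0")
    case True
    then show ?thesis
      by (auto simp: combinations_0_left combinations_0_right bottom_word_def top_word_def
          sign_replicate)
  next
    case False
    then obtain i j where kl: "k = Suc i" "l = Suc j"
      by (metis not0_implies_Suc)
    have "sum inversion_sign (combinations k l) =
        (\<Sum>w\<in>combinations i l. inversion_sign (False # w)) +
        (\<Sum>w\<in>combinations k j. inversion_sign (True # w))"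
      unfolding kl combinations_Suc_Suc
      by (subst sum.union_disjoint) (auto simp: finite_combinations sum.reindex)
    also have "\<dots> = sum inversion_sign (combinations i l) +
        (-1) ^ k * sum inversion_sign (combinations k j)"
      by (simp add: sum_distrib_left in_combinations_iff)
    finally show ?thesis
      using Suc.hyps(1)[of i l] Suc.hyps(1)[of k j] Suc.hyps(2) kl
      by (auto elim!: evenE oddE)
  qed
qed

lemma even_card_combinations:
  assumes "odd k" and "odd l"
  shows "even (card (combinations k l))"
proof -
  have "odd (inversion_sign w)" for w
    using abs_inversion_sign[of w] by (metis dvd_abs_iff odd_one)
  then have "even (\<Sum>w\<in>combinations k l. inversion_sign w + 1)"
    by (intro dvd_sum) simp
  then show ?thesis
    using assms by (simp add: sum.distrib sum_inversion_sign_combinations)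
qed

lemma abs_sum_inversion_sign_le_1:
  assumes "ham_path adj S x y"
  shows "\<bar>sum inversion_sign S\<bar> \<le> 1"
proof -
  have "sum inversion_sign S \<in> {0, inversion_sign x}"
    using assms
  proof (induction rule: ham_path.induct)
    case (ham_path_insert x y S z)
    then show ?case
      using inversion_sign_adj[of x y] finite_if_ham_path[of adj S y z] by auto
  qed simp
  then show ?thesis
    using abs_inversion_sign[of x] by auto
qed

lemma no_ham_path_combinations:
  assumes "2 \<le> k" and "2 \<le> l" and "even k \<or> even l"
  shows "\<not> ham_path adj (combinations k l) x y"
proof
  assume "ham_path adj (combinations k l) x y"
  then have le: "(k div 2 + l div 2) choose (k div 2) \<le> 1"
    using abs_sum_inversion_sign_le_1 assms(3) by (fastforce simp: sum_inversion_sign_combinations)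
  obtain m n where mn: "k div 2 = Suc m" "l div 2 = Suc n"
    using assms(1,2) by (metis div_greater_zero_iff gr0_implies_Suc zero_less_numeral)
  have "0 < (m + Suc n) choose m" "0 < (m + Suc n) choose Suc m"
    by simp_all
  moreover have "(Suc m + Suc n) choose Suc m = (m + Suc n choose m) + (m + Suc n choose Suc m)"
    by simp
  ultimately show False
    using le unfolding mn by linarith
qed


section \<open>Words with two leading bits\<close>

definition uniform :: "bool \<Rightarrow> bool list \<Rightarrow> bool list" where
  "uniform c w = c # c # w"

definition mixed :: "bool \<times> bool list \<Rightarrow> bool list" where
  "mixed p = fst p # (\<not> fst p) # snd p"

lemma inj_uniform: "inj (uniform c)"
  by (auto simp: inj_def uniform_def)

lemma inj_mixed: "inj mixed"
  by (auto simp: inj_def mixed_def prod_eq_iff)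

lemma uniform_neq_mixed: "uniform c w \<noteq> mixed p"
  by (auto simp: uniform_def mixed_def)

lemma adj_uniform: "adj (uniform c v) (uniform c w) \<longleftrightarrow> adj v w"
  by (simp add: uniform_def adj_Cons)

lemma adj_mixed: "adj (mixed p) (mixed q) \<longleftrightarrow> prism adj p q"
  by (auto simp: mixed_def prism_def adj_Cons)

lemma combinations_Suc_Suc_Suc_Suc:
  "combinations (Suc (Suc k)) (Suc (Suc l)) =
     uniform False ` combinations k (Suc (Suc l)) \<union>
     mixed ` (UNIV \<times> combinations (Suc k) (Suc l)) \<union>
     uniform True ` combinations (Suc (Suc k)) l"
proof -
  have "mixed ` (UNIV \<times> S) = (\<lambda>w. False # True # w) ` S \<union> (\<lambda>w. True # False # w) ` S" for S
    by (force simp: mixed_def UNIV_bool)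
  moreover have "(#) False ` combinations (Suc k) (Suc (Suc l)) =
      uniform False ` combinations k (Suc (Suc l)) \<union>
      (\<lambda>w. False # True # w) ` combinations (Suc k) (Suc l)"
    by (auto simp: combinations_Suc_Suc[of k] uniform_def)
  moreover have "(#) True ` combinations (Suc (Suc k)) (Suc l) =
      (\<lambda>w. True # False # w) ` combinations (Suc k) (Suc l) \<union>
      uniform True ` combinations (Suc (Suc k)) l"
    by (auto simp: combinations_Suc_Suc[of "Suc k" l] uniform_def)
  ultimately show ?thesis
    using combinations_Suc_Suc[of "Suc k" "Suc l"] by (simp add: Un_ac)
qed


section \<open>Hamilton paths in the graph of combinations\<close>

definition bottom_top_path :: "nat \<Rightarrow> nat \<Rightarrow> bool" where
  "bottom_top_path k l \<longleftrightarrow> ham_path adj (combinations k l) (bottom_word k l) (top_word k l)"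

lemma bottom_top_path_swap:
  assumes "bottom_top_path k l"
  shows "bottom_top_path l k"
proof -
  have "ham_path adj (map Not ` combinations k l)
      (map Not (bottom_word k l)) (map Not (top_word k l))"
    using assms unfolding bottom_top_path_def
    by (rule ham_path_image) (auto simp: adj_map_Not inj_on_def inj_def)
  then show ?thesis
    unfolding bottom_top_path_def map_Not_combinations map_Not_bottom_word map_Not_top_word
    by (rule ham_path_rev[OF symp_adj])
qed

lemma rung_path_top_word_if_bottom_word:
  assumes "rung_path adj (combinations l k) (bottom_word l k)"
  shows "rung_path adj (combinations k l) (top_word k l)"
proof -
  have "rung_path adj (map Not ` combinations l k) (map Not (bottom_word l k))"
    using assms by (rule rung_path_image) (auto simp: adj_map_Not inj_on_def inj_def)
  then show ?thesis
    by (simp add: map_Not_combinations map_Not_bottom_word)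
qed

lemma bottom_top_path_1_left: "bottom_top_path 1 l"
  unfolding bottom_top_path_def
proof (induction l)
  case 0
  then show ?case
    by (simp add: combinations_0_right bottom_word_def top_word_def ham_path_singleton)
next
  case (Suc l)
  have "ham_path adj ((#) True ` combinations 1 l) (True # bottom_word 1 l) (True # top_word 1 l)"
    by (rule ham_path_image[OF Suc]) (auto simp: adj_Cons)
  then have "ham_path adj (insert (bottom_word 1 (Suc l)) ((#) True ` combinations 1 l))
      (bottom_word 1 (Suc l)) (True # top_word 1 l)"
    by (rule ham_path_insert[rotated]) (auto simp: adj_Cons bottom_word_def)
  then show ?case
    using combinations_Suc_Suc[of 0 l] bottom_word_Suc_left[of 0 "Suc l"]
    by (simp add: combinations_0_left top_word_Suc_right)
qed

context
  fixes i j :: nat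
  assumes even_ij: "even i" "even j"
    and path: "bottom_top_path (Suc i) (Suc j)"
    and rung_left: "rung_path adj (combinations i (Suc (Suc j))) (top_word i (Suc (Suc j)))"
    and rung_right: "rung_path adj (combinations (Suc (Suc i)) j) (bottom_word (Suc (Suc i)) j)"
begin

text \<open>
  In the prism over \<open>C(i+2,j+2)\<close>, a path zigzags along the rungs over the words that start with \<open>01\<close>
  or \<open>10\<close>, which themselves form a prism. The parts over the words that start with \<open>00\<close> and \<open>11\<close> are
  detours from one rung each.
\<close>

definition cluster :: "bool list \<Rightarrow> bool list set" where
  "cluster g = insert g
     ((if g = mixed (False, False # top_word i (Suc j))
       then uniform False ` combinations i (Suc (Suc j)) else {}) \<union>
      (if g = mixed (True, True # bottom_word (Suc i) j)
       then uniform True ` combinations (Suc (Suc i)) j else {}))"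

lemma rung_path_cluster: "rung_path adj (cluster g) g"
proof -
  let ?u = "mixed (False, False # top_word i (Suc j))"
  let ?w = "mixed (True, True # bottom_word (Suc i) j)"
  have "rung_path adj (insert ?u (uniform False ` combinations i (Suc (Suc j)))) ?u"
    using rung_path_image[OF rung_left, of "uniform False"] uniform_neq_mixed
    by (intro rung_path_insert[OF symp_adj, where v = "uniform False (top_word i (Suc (Suc j)))"])
      (auto simp: inj_uniform[THEN inj_on_subset] adj_uniform top_word_Suc_right
        uniform_def mixed_def adj_Cons)
  moreover have "rung_path adj (insert ?w (uniform True ` combinations (Suc (Suc i)) j)) ?w"
    using rung_path_image[OF rung_right, of "uniform True"] uniform_neq_mixed
    by (intro rung_path_insert[OF symp_adj, where v = "uniform True (bottom_word (Suc (Suc i)) j)"])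
      (auto simp: inj_uniform[THEN inj_on_subset] adj_uniform bottom_word_Suc_left
        uniform_def mixed_def adj_Cons)
  moreover have "?u \<noteq> ?w"
    by (simp add: mixed_def)
  ultimately show ?thesis
    using rung_path_singleton unfolding cluster_def by auto
qed

lemma in_cluster_mixed_unique: "w \<in> cluster (mixed p) \<Longrightarrow> w \<in> cluster (mixed q) \<Longrightarrow> p = q"
  unfolding cluster_def by (auto simp: uniform_def mixed_def prod_eq_iff split: if_splits)

definition clusters :: "bool list set \<Rightarrow> bool list set" where
  "clusters S = (\<Union>g\<in>mixed ` (UNIV \<times> S). cluster g)"

lemma clusters_Un: "clusters (A \<union> B) = clusters A \<union> clusters B"
  by (auto simp: clusters_def)

lemma clusters_disjoint: "A \<inter> B = {} \<Longrightarrow> clusters A \<inter> clusters B = {}"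
  by (auto simp: clusters_def dest: in_cluster_mixed_unique)

lemma clusters_combinations:
  "clusters (combinations (Suc i) (Suc j)) = combinations (Suc (Suc i)) (Suc (Suc j))"
proof -
  let ?u = "mixed (False, False # top_word i (Suc j))"
  let ?w = "mixed (True, True # bottom_word (Suc i) j)"
  let ?F = "uniform False ` combinations i (Suc (Suc j))"
  let ?M = "mixed ` (UNIV \<times> combinations (Suc i) (Suc j))"
  let ?T = "uniform True ` combinations (Suc (Suc i)) j"
  have "?u \<in> ?M" "?w \<in> ?M"
    by (simp_all add: Cons_in_combinations_iff top_word_in_combinations bottom_word_in_combinations)
  then have "?F \<subseteq> (\<Union>g\<in>?M. cluster g)" "?T \<subseteq> (\<Union>g\<in>?M. cluster g)"
    by (auto simp: cluster_def)
  moreover have "?M \<subseteq> (\<Union>g\<in>?M. cluster g)"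
    unfolding cluster_def by blast
  moreover have "cluster g \<subseteq> insert g (?F \<union> ?T)" for g
    by (auto simp: cluster_def)
  then have "(\<Union>g\<in>?M. cluster g) \<subseteq> ?F \<union> ?M \<union> ?T"
    by fast
  ultimately show ?thesis
    unfolding combinations_Suc_Suc_Suc_Suc clusters_def by (intro subset_antisym Un_least)
qed

lemma ham_path_clusters:
  assumes "ham_path (prism adj) (UNIV \<times> S) p q"
  shows "ham_path (prism adj) (UNIV \<times> clusters S) (c, mixed p) (c, mixed q)"
proof -
  let ?M = "mixed ` (UNIV \<times> S)"
  have "ham_path adj ?M (mixed p) (mixed q)"
    using assms by (rule ham_path_image) (auto simp: adj_mixed inj_mixed[THEN inj_on_subset])
  moreover have "disjoint_family_on cluster ?M"
    by (auto simp: disjoint_family_on_def dest: in_cluster_mixed_unique)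
  ultimately have "ham_path (prism adj) (UNIV \<times> clusters S)
      (c, mixed p) (c \<longleftrightarrow> even (card ?M), mixed q)"
    unfolding clusters_def by (intro ham_path_prism_zigzag symp_adj rung_path_cluster)
  moreover have "even (card ?M)"
    by (simp add: card_image[OF inj_mixed[THEN inj_on_subset]] card_cartesian_product)
  ultimately show ?thesis
    by simp
qed

lemma ham_cycle_prism_step:
  "ham_cycle (prism adj) (UNIV \<times> combinations (Suc (Suc i)) (Suc (Suc j)))"
proof -
  let ?C = "combinations (Suc i) (Suc j)" and ?D = "combinations (Suc (Suc i)) (Suc (Suc j))"
  let ?s = "bottom_word (Suc i) (Suc j)"
  have "ham_path (prism adj) (UNIV \<times> ?C) (True, ?s) (False, ?s)"
    using ham_path_imp_rung_path[OF symp_adj path[unfolded bottom_top_path_def]]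
    by (simp add: rung_path_def)
  from ham_path_clusters[OF this]
  have "ham_path (prism adj) (UNIV \<times> ?D) (True, mixed (True, ?s)) (True, mixed (False, ?s))"
    unfolding clusters_combinations .
  moreover have "prism adj (True, mixed (False, ?s)) (True, mixed (True, ?s))"
    by (simp add: adj_mixed)
  moreover have "3 \<le> card ((UNIV :: bool set) \<times> ?D)"
  proof -
    let ?b = "bottom_word (Suc (Suc i)) (Suc (Suc j))"
    let ?t = "top_word (Suc (Suc i)) (Suc (Suc j))"
    have "card {?b, ?t} \<le> card ?D"
      using bottom_word_in_combinations top_word_in_combinations
      by (intro card_mono finite_combinations) simp
    moreover have "?b \<noteq> ?t"
      by (simp add: bottom_word_Suc_left top_word_Suc_right)
    ultimately show ?thesis by (simp add: card_cartesian_product)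
  qed
  ultimately show ?thesis
    unfolding ham_cycle_def by blast
qed

lemma rung_path_bottom_word_step:
  "rung_path adj (combinations (Suc (Suc i)) (Suc (Suc j)))
     (bottom_word (Suc (Suc i)) (Suc (Suc j)))"
  using ham_cycle_imp_rung_path[OF symp_adj ham_cycle_prism_step bottom_word_in_combinations]
    adj_bottom_word by blast

lemma rung_path_clusters_top_word:
  "rung_path adj (clusters {top_word (Suc i) (Suc j)}) (mixed (False, top_word (Suc i) (Suc j)))"
proof -
  let ?u = "mixed (False, top_word (Suc i) (Suc j))"
  let ?v = "mixed (True, top_word (Suc i) (Suc j))"
  have thin: "cluster ?u = {?u}"
    by (auto simp: cluster_def mixed_def top_word_Suc_right)
  then have "?u \<notin> cluster ?v"
    by (auto dest: in_cluster_mixed_unique)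
  then have "rung_path adj (insert ?u (cluster ?v)) ?u"
    by (intro rung_path_insert[OF symp_adj _ rung_path_cluster]) (simp_all add: adj_mixed)
  moreover have "clusters {top_word (Suc i) (Suc j)} = insert ?u (cluster ?v)"
    using thin by (auto simp: clusters_def UNIV_bool)
  ultimately show ?thesis by simp
qed

lemma ham_path_prism_step:
  "ham_path (prism adj) (UNIV \<times> combinations (Suc (Suc i)) (Suc (Suc j)))
     (False, mixed (False, top_word (Suc i) (Suc j)))
     (True, mixed (True, bottom_word (Suc i) (Suc j)))"
proof -
  let ?C = "combinations (Suc i) (Suc j)"
  let ?s = "bottom_word (Suc i) (Suc j)" and ?t = "top_word (Suc i) (Suc j)"
  have even_card: "even (card ?C)"
    using even_ij by (simp add: even_card_combinations)
  have "ham_path adj ?C ?t ?s"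
    using ham_path_rev[OF symp_adj] path by (simp add: bottom_top_path_def)
  then obtain u S where C: "?C = insert ?t S" "?t \<notin> S" and u: "adj ?t u" "ham_path adj S u ?s"
    by cases (use even_card in auto)
  have "odd (card S)"
    using even_card C finite_if_ham_path[OF u(2)] by simp
  then have "ham_path (prism adj) (UNIV \<times> S) (False, u) (True, ?s)"
    using ham_path_prism_zigzag[OF symp_adj u(2) rung_path_singleton, of False]
    by (simp add: disjoint_family_on_def)
  then have "ham_path (prism adj) (UNIV \<times> clusters S)
      (True, mixed (False, u)) (True, mixed (True, ?s))"
    by (rule ham_path_clusters)
  moreover have "ham_path (prism adj) (UNIV \<times> clusters {?t})
      (False, mixed (False, ?t)) (True, mixed (False, ?t))"
    using rung_pathD[OF symp_adj rung_path_clusters_top_word, of False] by simp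
  moreover have "clusters {?t} \<inter> clusters S = {}"
    using C(2) by (intro clusters_disjoint) simp
  ultimately have "ham_path (prism adj) (UNIV \<times> clusters {?t} \<union> UNIV \<times> clusters S)
      (False, mixed (False, ?t)) (True, mixed (True, ?s))"
    using u(1) by (intro ham_path_append) (auto simp: adj_mixed)
  moreover have "combinations (Suc (Suc i)) (Suc (Suc j)) = clusters {?t} \<union> clusters S"
    unfolding clusters_combinations[symmetric] clusters_Un[symmetric] using C(1) by simp
  ultimately show ?thesis
    by (simp only: Sigma_Un_distrib2)
qed

lemma bottom_top_path_step:
  assumes "bottom_top_path (Suc i) (Suc (Suc (Suc j)))"
    and "bottom_top_path (Suc (Suc (Suc i))) (Suc j)"
  shows "bottom_top_path (Suc (Suc (Suc i))) (Suc (Suc (Suc j)))"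
proof -
  let ?F = "uniform False ` combinations (Suc i) (Suc (Suc (Suc j)))"
  let ?M = "mixed ` (UNIV \<times> combinations (Suc (Suc i)) (Suc (Suc j)))"
  let ?T = "uniform True ` combinations (Suc (Suc (Suc i))) (Suc j)"
  have path_00: "ham_path adj ?F (uniform False (bottom_word (Suc i) (Suc (Suc (Suc j)))))
      (uniform False (top_word (Suc i) (Suc (Suc (Suc j)))))"
    using assms(1) unfolding bottom_top_path_def
    by (rule ham_path_image) (simp_all add: adj_uniform inj_uniform[THEN inj_on_subset])
  have path_01_10: "ham_path adj ?M (mixed (False, mixed (False, top_word (Suc i) (Suc j))))
      (mixed (True, mixed (True, bottom_word (Suc i) (Suc j))))"
    using ham_path_prism_step
    by (rule ham_path_image) (simp_all add: adj_mixed inj_mixed[THEN inj_on_subset])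
  have path_11: "ham_path adj ?T (uniform True (bottom_word (Suc (Suc (Suc i))) (Suc j)))
      (uniform True (top_word (Suc (Suc (Suc i))) (Suc j)))"
    using assms(2) unfolding bottom_top_path_def
    by (rule ham_path_image) (simp_all add: adj_uniform inj_uniform[THEN inj_on_subset])
  have "ham_path adj (?F \<union> ?M) (uniform False (bottom_word (Suc i) (Suc (Suc (Suc j)))))
     (mixed (True, mixed (True, bottom_word (Suc i) (Suc j))))"
    by (rule ham_path_append[OF path_00 _ path_01_10])
      (auto simp: uniform_neq_mixed uniform_def mixed_def adj_Cons top_word_Suc_right)
  then have "ham_path adj (?F \<union> ?M \<union> ?T) (uniform False (bottom_word (Suc i) (Suc (Suc (Suc j)))))
      (uniform True (top_word (Suc (Suc (Suc i))) (Suc j)))"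
    by (rule ham_path_append[OF _ _ path_11])
      (auto simp: uniform_def mixed_def adj_Cons bottom_word_Suc_left)
  then show ?thesis
    by (simp add: bottom_top_path_def combinations_Suc_Suc_Suc_Suc uniform_def
        bottom_word_Suc_left top_word_Suc_right)
qed

end

lemma bottom_top_path_odd_and_rung_path_even:
  "(odd k \<and> odd l \<longrightarrow> bottom_top_path k l) \<and>
   (even k \<and> even l \<longrightarrow> rung_path adj (combinations k l) (bottom_word k l))"
proof (induction "k + l" arbitrary: k l rule: less_induct)
  case less
  have IH_odd: "bottom_top_path m n" if "m + n < k + l" "odd m" "odd n" for m n
    using less that by blast
  have IH_even: "rung_path adj (combinations m n) (bottom_word m n)"
    "rung_path adj (combinations m n) (top_word m n)"
    if "m + n < k + l" "even m" "even n" for m n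
    using less[of m n] less[of n m] that rung_path_top_word_if_bottom_word by auto
  have "bottom_top_path k l" if "odd k" "odd l"
  proof -
    consider (left) "k = 1" | (right) "l = 1"
      | (step) i j where "k = Suc (Suc (Suc i))" "l = Suc (Suc (Suc j))"
      using \<open>odd k\<close> \<open>odd l\<close> by (metis One_nat_def even_Suc even_zero not0_implies_Suc)
    then show ?thesis
    proof cases
      case step
      show ?thesis
        unfolding step using that by (intro bottom_top_path_step IH_odd IH_even) (auto simp: step)
    qed (use bottom_top_path_1_left bottom_top_path_swap in auto)
  qed
  moreover have "rung_path adj (combinations k l) (bottom_word k l)" if "even k" "even l"
  proof -
    consider (left) "k = 0" | (right) "l = 0" | (step) i j where "k = Suc (Suc i)" "l = Suc (Suc j)"
      using \<open>even k\<close> \<open>even l\<close> by (metis even_Suc even_zero not0_implies_Suc)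
    then show ?thesis
    proof cases
      case step
      show ?thesis
        unfolding step using that
        by (intro rung_path_bottom_word_step IH_odd IH_even) (auto simp: step)
    qed (auto simp: combinations_0_left combinations_0_right bottom_word_def top_word_def
        rung_path_singleton)
  qed
  ultimately show ?case by blast
qed

theorem ham_path_combinations_iff:
  "(\<exists>x y. ham_path adj (combinations k l) x y) \<longleftrightarrow> k \<le> 1 \<or> l \<le> 1 \<or> (odd k \<and> odd l)"
proof
  assume "\<exists>x y. ham_path adj (combinations k l) x y"
  then show "k \<le> 1 \<or> l \<le> 1 \<or> (odd k \<and> odd l)"
    using no_ham_path_combinations[of k l] by fastforce
next
  assume "k \<le> 1 \<or> l \<le> 1 \<or> (odd k \<and> odd l)"
  then consider "k = 0" | "l = 0" | "bottom_top_path k l"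
    using bottom_top_path_1_left[of l] bottom_top_path_swap[OF bottom_top_path_1_left, of k]
      bottom_top_path_odd_and_rung_path_even[of k l] by (fastforce simp: le_Suc_eq)
  then show "\<exists>x y. ham_path adj (combinations k l) x y"
    by cases
      (metis ham_path_singleton bottom_top_path_def combinations_0_left combinations_0_right)+
qed

theorem no_ham_cycle_combinations: "\<not> ham_cycle adj (combinations k l)"
proof
  assume "ham_cycle adj (combinations k l)"
  then obtain v w where "v \<noteq> w" "adj (bottom_word k l) v" "adj (bottom_word k l) w"
    using ham_cycle_two_neighbours[OF symp_adj _ bottom_word_in_combinations] by metis
  then show False
    using adj_bottom_word by metis
qed


section \<open>Edges of triangulations\<close>

definition edges :: "nat \<Rightarrow> nat set set \<Rightarrow> nat set set" where
  "edges N T = polygon_sides N \<union> T"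

lemma side_iff:
  assumes "p < q" and "3 \<le> N"
  shows "{p, q} \<in> polygon_sides N \<longleftrightarrow> 1 \<le> p \<and> q \<le> N \<and> (q = Suc p \<or> p = 1 \<and> q = N)"
  using assms by (auto simp: polygon_sides_def doubleton_eq_iff)

lemma diagonal_iff:
  assumes "p < q" and "3 \<le> N"
  shows "{p, q} \<in> diagonals N \<longleftrightarrow> 1 \<le> p \<and> q \<le> N \<and> q \<noteq> Suc p \<and> \<not> (p = 1 \<and> q = N)"
proof -
  have "{p, q} \<in> {{i, j} | i j. i \<in> {1..N} \<and> j \<in> {1..N} \<and> i \<noteq> j} \<longleftrightarrow> 1 \<le> p \<and> q \<le> N"
    using assms(1) by (fastforce simp: doubleton_eq_iff)
  then show ?thesis
    unfolding diagonals_def using side_iff[OF assms] by auto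
qed

lemma side_or_diagonalE:
  assumes "e \<in> polygon_sides N \<or> e \<in> diagonals N" and "3 \<le> N"
  obtains p q where "e = {p, q}" and "p < q" and "1 \<le> p" and "q \<le> N"
proof -
  obtain i j where "e = {i, j}" "i \<in> {1..N}" "j \<in> {1..N}" "i \<noteq> j"
    using assms by (fastforce simp: polygon_sides_def diagonals_def)
  then show thesis
    using that[of i j] that[of j i] by (cases "i < j") (auto simp: insert_commute)
qed

lemma crossing_commute: "crossing e f \<longleftrightarrow> crossing f e"
  unfolding crossing_def by (simp add: insert_commute)

lemma crossing_iff:
  assumes "p < q" and "r < s"
  shows "crossing {p, q} {r, s} \<longleftrightarrow> p < r \<and> r < q \<and> q < s \<or> r < p \<and> p < s \<and> s < q"
proof
  assume "crossing {p, q} {r, s}"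
  then obtain i j k l where "i < j" "j < k" "k < l" "{{p, q}, {r, s}} = {{i, k}, {j, l}}"
    unfolding crossing_def by blast
  moreover from this have "{p, q} = {i, k} \<and> {r, s} = {j, l} \<or> {p, q} = {j, l} \<and> {r, s} = {i, k}"
    by (auto simp: doubleton_eq_iff)
  ultimately show "p < r \<and> r < q \<and> q < s \<or> r < p \<and> p < s \<and> s < q"
    using assms by (auto simp: doubleton_eq_iff)
next
  have "crossing {p, q} {r, s}" if "p < r" "r < q" "q < s" for p q r s :: nat
    using that unfolding crossing_def by blast
  moreover assume "p < r \<and> r < q \<and> q < s \<or> r < p \<and> p < s \<and> s < q"
  ultimately show "crossing {p, q} {r, s}"
    using crossing_commute by blast
qed

lemma side_not_crossed:
  assumes "3 \<le> N" and "1 \<le> p" and "p < q" and "q \<le> N" and "e \<in> polygon_sides N"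
  shows "\<not> crossing {p, q} e"
proof -
  obtain r s where "e = {r, s}" "r < s"
    using side_or_diagonalE assms by metis
  then show ?thesis
    using assms by (auto simp: crossing_iff side_iff)
qed

lemma trianglesI:
  assumes "p \<noteq> q" and "q \<noteq> r" and "p \<noteq> r"
    and "{p, q} \<in> edges N T" and "{q, r} \<in> edges N T" and "{p, r} \<in> edges N T"
  shows "{p, q, r} \<in> triangles N T"
  unfolding triangles_def using assms unfolding edges_def by blast

lemma trianglesE:
  assumes "t \<in> triangles N T"
  obtains p q r where "t = {p, q, r}" and "p \<noteq> q" and "q \<noteq> r" and "p \<noteq> r"
    and "{p, q} \<in> edges N T" and "{q, r} \<in> edges N T" and "{p, r} \<in> edges N T"
proof -
  obtain p q r where "t = {p, q, r}" "p \<noteq> q \<and> q \<noteq> r \<and> p \<noteq> r"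
    "{{p, q}, {q, r}, {p, r}} \<subseteq> polygon_sides N \<union> T"
    using assms unfolding triangles_def by blast
  then show thesis by (intro that[of p q r]) (auto simp: edges_def)
qed

lemma flipI:
  assumes "{p, q} \<in> T" and "p \<noteq> q" and "r \<noteq> s" and "r \<notin> {p, q}" and "s \<notin> {p, q}"
    and "{p, r} \<in> edges N T" and "{q, r} \<in> edges N T"
    and "{p, s} \<in> edges N T" and "{q, s} \<in> edges N T"
  shows "flip N T (T - {{p, q}} \<union> {{r, s}})"
proof -
  have "{p, q} \<in> edges N T"
    using assms(1) by (simp add: edges_def)
  then have "{p, q, r} \<in> triangles N T" "{p, q, s} \<in> triangles N T"
    using assms by (auto intro!: trianglesI)
  with assms(1,3) show ?thesis
    unfolding flip_def by blast
qed

lemma flipE: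
  assumes "flip N T T'"
  obtains e f where "e \<in> T" and "e \<noteq> f" and "T' = T - {e} \<union> {f}"
proof -
  obtain p q r s where pqrs: "{p, q} \<in> T" "{p, q, r} \<in> triangles N T" "T' = T - {{p, q}} \<union> {{r, s}}"
    using assms unfolding flip_def by blast
  have "card {p, q, r} = 3"
    by (rule trianglesE[OF pqrs(2)]) simp
  then have "{p, q} \<noteq> {r, s}"
    by (auto simp: card_insert_if split: if_splits)
  with pqrs show thesis by (intro that)
qed

lemma triangulation_subset_imp_eq:
  assumes "triangulation N S" and "triangulation N T" and "S \<subseteq> T"
  shows "S = T"
  using assms unfolding triangulation_def by blast

lemma triangulation_edgeE:
  assumes "triangulation N T" and "3 \<le> N" and "e \<in> edges N T"
  obtains p q where "e = {p, q}" and "p < q" and "1 \<le> p" and "q \<le> N"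
  using assms side_or_diagonalE[of e N] unfolding edges_def triangulation_def by blast

lemma triangulation_edges_noncrossing:
  assumes "triangulation N T" and "3 \<le> N" and "e \<in> edges N T" and "f \<in> edges N T"
  shows "\<not> crossing e f"
proof -
  have side: "\<not> crossing g h" if "g \<in> edges N T" "h \<in> polygon_sides N" for g h
    using that assms(1,2) by (metis side_not_crossed triangulation_edgeE)
  consider "e \<in> polygon_sides N" | "f \<in> polygon_sides N" | "e \<in> T" "f \<in> T"
    using assms(3,4) unfolding edges_def by blast
  then show ?thesis
    by cases (use assms side crossing_commute in \<open>auto simp: triangulation_def\<close>)
qed

lemma triangulation_edgeI:
  assumes "triangulation N T" and "3 \<le> N" and "1 \<le> p" and "p < q" and "q \<le> N"
    and "\<And>u v. u < v \<Longrightarrow> {u, v} \<in> edges N T \<Longrightarrow> \<not> crossing {p, q} {u, v}"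
  shows "{p, q} \<in> edges N T"
proof (rule ccontr)
  assume notin: "{p, q} \<notin> edges N T"
  then have "{p, q} \<in> diagonals N - T"
    using assms(2-5) by (auto simp: edges_def diagonal_iff side_iff)
  then obtain e where e: "e \<in> T" "crossing {p, q} e"
    using assms(1) unfolding triangulation_def by blast
  then have "e \<in> edges N T"
    by (simp add: edges_def)
  then show False
    using e(2) assms(6) triangulation_edgeE[OF assms(1,2)] by metis
qed

text \<open>The apex is the last point before \<open>j\<close> that is joined to \<open>i\<close>.\<close>

lemma triangulation_triangle_between:
  assumes T: "triangulation N T" "3 \<le> N" and ij: "{i, j} \<in> T" "i < j"
  obtains k where "i < k" and "k < j" and "{i, j, k} \<in> triangles N T"
proof -
  have ij_edge: "{i, j} \<in> edges N T"
    using ij(1) by (simp add: edges_def)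
  have bounds: "1 \<le> i" "j \<le> N" "j \<noteq> Suc i"
    using T ij by (auto simp: diagonal_iff triangulation_def)
  define K where "K = {k. i < k \<and> k < j \<and> {i, k} \<in> edges N T}"
  have "finite K"
    by (rule finite_subset[of _ "{..j}"]) (auto simp: K_def)
  moreover have "Suc i \<in> K"
    using bounds ij(2) T(2) by (auto simp: K_def edges_def side_iff)
  ultimately obtain k where "k \<in> K" and k_max: "\<And>u. u \<in> K \<Longrightarrow> u \<le> k"
    using Max_in Max_ge by (metis empty_iff)
  then have k: "i < k" "k < j" "{i, k} \<in> edges N T"
    by (auto simp: K_def)
  have "{k, j} \<in> edges N T"
  proof (rule triangulation_edgeI[OF T])
    fix u v assume uv: "u < v" "{u, v} \<in> edges N T"
    have "\<not> crossing {i, j} {u, v}" "\<not> crossing {i, k} {u, v}"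
      by (rule triangulation_edges_noncrossing[OF T _ uv(2)]; fact)+
    moreover have "\<not> (u = i \<and> k < v \<and> v < j)"
      using uv(2) k k_max[of v] by (auto simp: K_def)
    ultimately show "\<not> crossing {k, j} {u, v}"
      using uv(1) ij(2) k(1,2) by (auto simp: crossing_iff)
  qed (use k bounds in auto)
  with k ij_edge have "{i, j, k} \<in> triangles N T"
    by (intro trianglesI) (auto simp: insert_commute)
  with k show thesis by (intro that)
qed


section \<open>Lattice paths\<close>

definition lattice_point :: "bool list \<Rightarrow> nat \<Rightarrow> nat \<times> nat" where
  "lattice_point w i = (count_list (take i w) False, count_list (take i w) True)"

definition lattice_path :: "bool list \<Rightarrow> (nat \<times> nat) set" where
  "lattice_path w = lattice_point w ` {..length w}"

lemma length_combinations: "w \<in> combinations k l \<Longrightarrow> length w = k + l"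
  by (simp add: combinations_def)

lemma lattice_point_0: "lattice_point w 0 = (0, 0)"
  by (simp add: lattice_point_def)

lemma lattice_point_end: "w \<in> combinations k l \<Longrightarrow> length w \<le> i \<Longrightarrow> lattice_point w i = (k, l)"
  by (simp add: lattice_point_def in_combinations_iff)

lemma lattice_point_Suc:
  assumes "i < length w"
  shows "lattice_point w (Suc i) =
    (fst (lattice_point w i) + (if w ! i then 0 else 1),
     snd (lattice_point w i) + (if w ! i then 1 else 0))"
  using assms by (simp add: lattice_point_def take_Suc_conv_app_nth)

lemma lattice_point_level:
  assumes "i \<le> length w"
  shows "fst (lattice_point w i) + snd (lattice_point w i) = i"
  using assms by (induction i) (auto simp: lattice_point_0 lattice_point_Suc)

lemma mono_lattice_point: "mono (lattice_point w)"
proof (rule monoI)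
  fix i j :: nat assume "i \<le> j"
  then have "take j w = take i w @ take (j - i) (drop i w)"
    by (metis le_add_diff_inverse take_add)
  then show "lattice_point w i \<le> lattice_point w j"
    by (simp add: lattice_point_def)
qed

lemma lattice_point_le: "w \<in> combinations k l \<Longrightarrow> lattice_point w i \<le> (k, l)"
  using monoD[OF mono_lattice_point, of i "max i (length w)" w] by (simp add: lattice_point_end)

lemma lattice_point_in_lattice_path: "i \<le> length w \<Longrightarrow> lattice_point w i \<in> lattice_path w"
  by (simp add: lattice_path_def)

lemma in_lattice_path_iff:
  "p \<in> lattice_path w \<longleftrightarrow> fst p + snd p \<le> length w \<and> lattice_point w (fst p + snd p) = p"
  (is "_ \<longleftrightarrow> ?rhs")
proof
  assume "p \<in> lattice_path w"
  then show ?rhs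
    by (auto simp: lattice_path_def lattice_point_level)
next
  assume ?rhs
  then show "p \<in> lattice_path w"
    using lattice_point_in_lattice_path by metis
qed

lemma lattice_path_start: "(0, 0) \<in> lattice_path w"
  by (simp add: in_lattice_path_iff lattice_point_0)

lemma lattice_path_end: "w \<in> combinations k l \<Longrightarrow> (k, l) \<in> lattice_path w"
  by (simp add: in_lattice_path_iff lattice_point_end length_combinations)

lemma chain_lattice_path: "Complete_Partial_Order.chain (\<le>) (lattice_path w)"
proof (rule chainI)
  fix p q assume "p \<in> lattice_path w" "q \<in> lattice_path w"
  then obtain i j where "p = lattice_point w i" "q = lattice_point w j"
    by (auto simp: lattice_path_def)
  then show "p \<le> q \<or> q \<le> p"
    using monoD[OF mono_lattice_point] nat_le_linear[of i j] by metis
qed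

lemma lattice_path_snoc:
  "lattice_path (w @ [c]) =
     insert (count_list (w @ [c]) False, count_list (w @ [c]) True) (lattice_path w)"
proof -
  have "lattice_point (w @ [c]) ` {..length w} = lattice_path w"
    unfolding lattice_path_def by (intro image_cong) (simp_all add: lattice_point_def)
  moreover have "lattice_path (w @ [c]) =
      insert (lattice_point (w @ [c]) (Suc (length w))) (lattice_point (w @ [c]) ` {..length w})"
    by (simp add: lattice_path_def atMost_Suc)
  moreover have "lattice_point (w @ [c]) (Suc (length w)) =
      (count_list (w @ [c]) False, count_list (w @ [c]) True)"
    by (simp add: lattice_point_def)
  ultimately show ?thesis by simp
qed

lemma count_list_take_eqE:
  assumes "n \<le> count_list w c"
  obtains i where "i \<le> length w" and "count_list (take i w) c = n"
proof -
  have "\<exists>i\<le>length w. int (count_list (take i w) c) = int n"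
    by (rule nat0_intermed_int_val) (use assms in \<open>auto simp: take_Suc_conv_app_nth\<close>)
  then show thesis using that by auto
qed

lemma incomparable_on_lattice_pathE:
  assumes "w \<in> combinations k l" and "p \<le> (k, l)" and "p \<notin> lattice_path w"
  obtains q where "q \<in> lattice_path w" and "\<not> p \<le> q" and "\<not> q \<le> p"
proof -
  define q where "q = lattice_point w (fst p + snd p)"
  have "fst p + snd p \<le> length w"
    using assms(1,2) by (simp add: length_combinations less_eq_prod_def)
  then have "q \<in> lattice_path w" "fst q + snd q = fst p + snd p"
    by (auto simp: q_def lattice_path_def lattice_point_level)
  moreover have "\<not> r \<le> s" if "r \<noteq> s" "fst r + snd r = fst s + snd s" for r s :: "nat \<times> nat"
    using that by (auto simp: less_eq_prod_def prod_eq_iff)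
  ultimately show thesis
    using that assms(3) by metis
qed

lemma chain_below_corner:
  fixes K :: "(nat \<times> nat) set"
  assumes "Complete_Partial_Order.chain (\<le>) K" and "K \<subseteq> {..(k, l)}" and "(k, l) \<noteq> (0, 0)"
  shows "0 < k \<and> K - {(k, l)} \<subseteq> {..(k - 1, l)} \<or> 0 < l \<and> K - {(k, l)} \<subseteq> {..(k, l - 1)}"
proof (cases "\<exists>y<l. (k, y) \<in> K")
  case True
  then obtain y where y: "y < l" "(k, y) \<in> K" by blast
  have "K - {(k, l)} \<subseteq> {..(k, l - 1)}"
  proof (rule subrelI)
    fix u v assume uv: "(u, v) \<in> K - {(k, l)}"
    then have "(u, v) \<le> (k, y) \<or> (k, y) \<le> (u, v)"
      using chainD[OF assms(1) _ y(2)] by blast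
    moreover have "u \<le> k" "v \<le> l" "u \<noteq> k \<or> v \<noteq> l"
      using uv assms(2) by auto
    ultimately show "(u, v) \<in> {..(k, l - 1)}"
      using y(1) by auto
  qed
  with y(1) show ?thesis by simp
next
  case False
  have below: "u < k \<and> v \<le> l" if "(u, v) \<in> K - {(k, l)}" for u v
  proof -
    have "u \<le> k" "v \<le> l" "u \<noteq> k \<or> v \<noteq> l"
      using that assms(2) by auto
    then show ?thesis
      using False that by (metis DiffD1 le_neq_implies_less)
  qed
  then have "K - {(k, l)} \<subseteq> {..(k - 1, l)}"
    by (intro subrelI) fastforce
  moreover have "k = 0 \<Longrightarrow> K - {(k, l)} = {}"
    using below by fastforce
  moreover have "0 < k \<or> 0 < l"
    using assms(3) by simp
  ultimately show ?thesis
    by (metis empty_subsetI gr0I)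
qed

lemma chain_subset_lattice_path:
  fixes K :: "(nat \<times> nat) set"
  assumes "Complete_Partial_Order.chain (\<le>) K" and "K \<subseteq> {..(k, l)}"
  shows "\<exists>w\<in>combinations k l. K \<subseteq> lattice_path w"
  using assms
proof (induction "k + l" arbitrary: k l K rule: less_induct)
  case less
  have extend: ?case
    if c: "w @ [c] \<in> combinations k l" and w: "K - {(k, l)} \<subseteq> lattice_path w" for w c
    by (rule bexI[OF _ c]) (use w c in \<open>auto simp: lattice_path_snoc in_combinations_iff\<close>)
  have chain: "Complete_Partial_Order.chain (\<le>) (K - {(k, l)})"
    using less.prems(1) by (auto simp: chain_def)
  consider (origin) "(k, l) = (0, 0)"
    | (last_False) "0 < k" "K - {(k, l)} \<subseteq> {..(k - 1, l)}"
    | (last_True) "0 < l" "K - {(k, l)} \<subseteq> {..(k, l - 1)}"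
    using chain_below_corner[OF less.prems] by blast
  then show ?case
  proof cases
    case origin
    then have "K \<subseteq> {(0, 0)}"
      using less.prems(2) by (auto simp: subset_iff)
    moreover have "[] \<in> combinations k l"
      using origin by (simp add: in_combinations_iff)
    ultimately show ?thesis
      using lattice_path_start by blast
  next
    case last_False
    then obtain w where "w \<in> combinations (k - 1) l" "K - {(k, l)} \<subseteq> lattice_path w"
      using less.hyps[of "k - 1" l, OF _ chain] by auto
    then show ?thesis
      using last_False(1) by (intro extend[of w False]) (auto simp: in_combinations_iff)
  next
    case last_True
    then obtain w where "w \<in> combinations k (l - 1)" "K - {(k, l)} \<subseteq> lattice_path w"
      using less.hyps[of k "l - 1", OF _ chain] by auto
    then show ?thesis
      using last_True(1) by (intro extend[of w True]) (auto simp: in_combinations_iff)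
  qed
qed

lemma nth_eq_if_lattice_point_eq:
  assumes "i < length v" and "i < length w" and "lattice_point v i = lattice_point w i"
    and "lattice_point v (Suc i) = lattice_point w (Suc i)"
  shows "v ! i = w ! i"
  using assms by (auto simp: lattice_point_Suc split: if_splits)

lemma lattice_point_inject:
  assumes "length v = length w" and "lattice_point v = lattice_point w"
  shows "v = w"
  using assms by (intro nth_equalityI nth_eq_if_lattice_point_eq) simp_all

lemma adj_lattice_pointE:
  assumes "adj v w"
  obtains i x y where "Suc (Suc i) \<le> length v"
    and "lattice_point v i = (x, y)" and "lattice_point v (Suc (Suc i)) = (Suc x, Suc y)"
    and "{lattice_point v (Suc i), lattice_point w (Suc i)} = {(Suc x, y), (x, Suc y)}"
    and "lattice_point w = (lattice_point v)(Suc i := lattice_point w (Suc i))"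
proof -
  obtain u c z where vw: "v = u @ c # (\<not> c) # z" "w = u @ (\<not> c) # c # z"
    using assms unfolding adj_iff_append by blast
  have "lattice_point w j = lattice_point v j" if "j \<noteq> Suc (length u)" for j
  proof (cases "j \<le> length u")
    case False
    define n where "n = j - Suc (Suc (length u))"
    have "j = length u + Suc (Suc n)"
      using False that by (simp add: n_def)
    then show ?thesis by (simp add: lattice_point_def vw)
  qed (simp add: lattice_point_def vw)
  then show thesis
    by (intro that[of "length u" "count_list u False" "count_list u True"])
      (auto simp: lattice_point_def vw)
qed

lemma adj_if_lattice_point_differ_once:
  assumes "length v = length w" and differ: "lattice_point w i \<noteq> lattice_point v i"
    and other: "\<And>j. j \<noteq> i \<Longrightarrow> lattice_point w j = lattice_point v j"
  shows "adj v w"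
proof -
  obtain m where m: "i = Suc m"
    using differ by (cases i) (auto simp: lattice_point_0)
  have "i < length v"
  proof (rule ccontr)
    assume "\<not> i < length v"
    then have "lattice_point v (Suc i) = lattice_point v i"
      "lattice_point w (Suc i) = lattice_point w i"
      using assms(1) by (simp_all add: lattice_point_def)
    with differ other[of "Suc i"] show False by simp
  qed
  have same: "w ! j = v ! j" if "j < length v" "j \<noteq> m" "j \<noteq> i" for j
    using that other[of j] other[of "Suc j"] assms(1) m by (intro nth_eq_if_lattice_point_eq) auto
  have "w ! m \<noteq> v ! m"
    using differ other[of m] \<open>i < length v\<close> assms(1) unfolding m
    by (auto simp: lattice_point_Suc split: if_splits)
  moreover have "w ! m = v ! i \<and> w ! i = v ! m \<or> w ! m = v ! m"
    using other[of m] other[of "Suc i"] \<open>i < length v\<close> assms(1) unfolding m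
    by (auto simp: lattice_point_Suc split: if_splits)
  ultimately have swapped: "v ! m \<noteq> v ! i" "w ! m = v ! i" "w ! i = v ! m"
    by auto
  moreover have "w = v[m := v ! i, i := v ! m]"
  proof (rule nth_equalityI)
    fix j assume "j < length w"
    then show "w ! j = v[m := v ! i, i := v ! m] ! j"
      using assms(1) swapped(2,3) same[of j] m by (cases "j = m"; cases "j = i") simp_all
  qed (simp add: assms(1))
  ultimately show ?thesis
    unfolding adjacent_transposition_def using \<open>i < length v\<close> m by blast
qed

lemma lattice_path_fun_upd:
  assumes "lattice_point w = (lattice_point v)(i := p)" and "length v = length w" and "i \<le> length v"
  shows "lattice_path w = insert p (lattice_path v - {lattice_point v i})"
proof -
  have "inj_on (lattice_point v) {..length v}"
    by (rule inj_onI) (metis atMost_iff lattice_point_level)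
  then have "lattice_point v ` ({..length v} - {i}) = lattice_path v - {lattice_point v i}"
    using assms(3) by (simp add: lattice_path_def inj_on_image_set_diff[of _ "{..length v}"])
  moreover have "lattice_path w = insert p (lattice_point v ` ({..length v} - {i}))"
    unfolding lattice_path_def assms(1) using assms(2,3)
    by (simp only: fun_upd_image atMost_iff if_True)
  ultimately show ?thesis by simp
qed

lemma lattice_point_eq_if_in_lattice_path:
  "lattice_point v i \<in> lattice_path w \<Longrightarrow> i \<le> length v \<Longrightarrow> lattice_point w i = lattice_point v i"
  by (simp add: in_lattice_path_iff lattice_point_level)


section \<open>Colorful triangulations as lattice paths\<close>

locale bicolored_polygon =
  fixes a b :: nat
  assumes red_nonempty: "1 \<le> a" and blue_nonempty: "1 \<le> b" and three_points: "3 \<le> a + b"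
begin

abbreviation words :: "bool list set" where
  "words \<equiv> combinations (a - 1) (b - 1)"

definition segment :: "nat \<times> nat \<Rightarrow> nat set" where
  "segment p = {a - fst p, Suc (a + snd p)}"

definition path_triangulation :: "bool list \<Rightarrow> nat set set" where
  "path_triangulation w = segment ` lattice_path w - polygon_sides (a + b)"

lemma le_corner_iff: "p \<le> (a - 1, b - 1) \<longleftrightarrow> fst p < a \<and> snd p < b"
  using red_nonempty blue_nonempty by (cases p) auto

lemma in_lattice_path_bounds:
  assumes "w \<in> words" and "p \<in> lattice_path w"
  shows "fst p < a" and "snd p < b"
proof -
  have "p \<le> (a - 1, b - 1)"
    using assms lattice_point_le unfolding lattice_path_def by blast
  then show "fst p < a" "snd p < b"
    unfolding le_corner_iff by simp_all
qed

lemma segment_eq_iff: "fst p < a \<Longrightarrow> fst q < a \<Longrightarrow> segment p = segment q \<longleftrightarrow> p = q"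
  by (auto simp: segment_def doubleton_eq_iff prod_eq_iff)

lemma bichromatic_eq_segment: "p \<le> a \<Longrightarrow> a < q \<Longrightarrow> {p, q} = segment (a - p, q - Suc a)"
  by (auto simp: segment_def)

lemma crossing_segment_iff:
  assumes "fst p < a" and "fst q < a"
  shows "crossing (segment p) (segment q) \<longleftrightarrow> \<not> (p \<le> q \<or> q \<le> p)"
  unfolding segment_def using assms by (subst crossing_iff) (auto simp: less_eq_prod_def)

lemma segment_side_iff:
  assumes "fst p < a" and "snd p < b"
  shows "segment p \<in> polygon_sides (a + b) \<longleftrightarrow> p = (0, 0) \<or> p = (a - 1, b - 1)"
  unfolding segment_def using assms three_points by (subst side_iff) (auto simp: prod_eq_iff)

lemma segment_in_edges_iff:
  assumes "w \<in> words" and "fst p < a" and "snd p < b"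
  shows "segment p \<in> edges (a + b) (path_triangulation w) \<longleftrightarrow> p \<in> lattice_path w"
proof -
  have "segment p \<in> segment ` lattice_path w \<longleftrightarrow> p \<in> lattice_path w"
    using assms in_lattice_path_bounds by (auto simp: segment_eq_iff image_iff)
  then show ?thesis
    using segment_side_iff[OF assms(2,3)] lattice_path_start lattice_path_end[OF assms(1)]
    by (auto simp: edges_def path_triangulation_def)
qed

lemma lattice_point_segment_in_edges:
  assumes "w \<in> words" and "i \<le> length w"
  shows "segment (lattice_point w i) \<in> edges (a + b) (path_triangulation w)"
  using assms segment_in_edges_iff in_lattice_path_bounds lattice_point_in_lattice_path by blast

lemma inj_on_path_triangulation: "inj_on path_triangulation words"
proof (rule inj_onI)
  fix v w assume vw: "v \<in> words" "w \<in> words" "path_triangulation v = path_triangulation w"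
  have "lattice_point v i = lattice_point w i" for i
  proof (cases "i \<le> length v")
    case True
    then have "lattice_point v i \<in> lattice_path w"
      using vw lattice_point_segment_in_edges segment_in_edges_iff in_lattice_path_bounds
        lattice_point_in_lattice_path by metis
    then show ?thesis
      using lattice_point_eq_if_in_lattice_path True by metis
  qed (use vw lattice_point_end in \<open>simp add: length_combinations\<close>)
  then show "v = w"
    using vw(1,2) by (intro lattice_point_inject) (auto simp: length_combinations)
qed

lemma path_triangulation_exchange:
  assumes "v \<in> words" and "length v = length w" and "i \<le> length v"
    and upd: "lattice_point w = (lattice_point v)(i := p)"
    and no_side: "segment p \<notin> polygon_sides (a + b)"
  shows "path_triangulation w = path_triangulation v - {segment (lattice_point v i)} \<union> {segment p}"
proof -
  have "inj_on segment (lattice_path v)"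
    using segment_eq_iff in_lattice_path_bounds[OF assms(1)] by (intro inj_onI) blast
  then have "segment ` (lattice_path v - {lattice_point v i}) =
      segment ` lattice_path v - {segment (lattice_point v i)}"
    using lattice_point_in_lattice_path[OF assms(3)]
    by (simp add: inj_on_image_set_diff[of segment "lattice_path v"])
  then show ?thesis
    using lattice_path_fun_upd[OF upd assms(2,3)] no_side by (auto simp: path_triangulation_def)
qed

lemma path_triangulation_subset_diagonals:
  assumes "w \<in> words"
  shows "path_triangulation w \<subseteq> diagonals (a + b)"
proof
  fix d assume d: "d \<in> path_triangulation w"
  then obtain p where p: "p \<in> lattice_path w" "d = segment p"
    by (auto simp: path_triangulation_def)
  then have "a - fst p \<in> {1..a + b}" "Suc (a + snd p) \<in> {1..a + b}" "a - fst p \<noteq> Suc (a + snd p)"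
    using in_lattice_path_bounds[OF assms] by fastforce+
  then show "d \<in> diagonals (a + b)"
    using d p(2) unfolding diagonals_def path_triangulation_def segment_def by blast
qed

lemma path_triangulation_noncrossing:
  assumes "w \<in> words" and "d \<in> path_triangulation w" and "e \<in> path_triangulation w"
  shows "\<not> crossing d e"
proof -
  obtain p q where "d = segment p" "e = segment q" "p \<in> lattice_path w" "q \<in> lattice_path w"
    using assms(2,3) by (auto simp: path_triangulation_def)
  then show ?thesis
    using chainD[OF chain_lattice_path] in_lattice_path_bounds[OF assms(1)]
    by (simp add: crossing_segment_iff)
qed

lemma red_segment_crosses_lattice_path:
  assumes "w \<in> words" and "1 \<le> p" and "Suc p < q" and "q \<le> a"
  obtains r where "r \<in> lattice_path w" and "crossing {p, q} (segment r)"
proof -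
  have "a - Suc p \<le> count_list w False"
    using assms(1) by (simp add: in_combinations_iff)
  then obtain i where i: "i \<le> length w" "count_list (take i w) False = a - Suc p"
    by (rule count_list_take_eqE)
  have "segment (lattice_point w i) = {Suc p, Suc (a + snd (lattice_point w i))}"
    using i(2) assms by (simp add: segment_def lattice_point_def)
  moreover have "crossing {p, q} {Suc p, Suc (a + y)}" for y
    using assms by (subst crossing_iff) auto
  ultimately show thesis
    using that[of "lattice_point w i"] i(1) by (simp add: lattice_path_def)
qed

lemma blue_segment_crosses_lattice_path:
  assumes "w \<in> words" and "a < p" and "Suc p < q" and "q \<le> a + b"
  obtains r where "r \<in> lattice_path w" and "crossing {p, q} (segment r)"
proof -
  have "p - a \<le> count_list w True"
    using assms by (simp add: in_combinations_iff)
  then obtain i where i: "i \<le> length w" "count_list (take i w) True = p - a"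
    by (rule count_list_take_eqE)
  have "segment (lattice_point w i) = {a - fst (lattice_point w i), Suc p}"
    using i(2) assms by (simp add: segment_def lattice_point_def)
  moreover have "crossing {p, q} {a - x, Suc p}" for x
    using assms by (subst crossing_iff) auto
  ultimately show thesis
    using that[of "lattice_point w i"] i(1) by (simp add: lattice_path_def)
qed

lemma diagonal_crosses_lattice_path:
  assumes "w \<in> words" and "d \<in> diagonals (a + b) - path_triangulation w"
  obtains r where "r \<in> lattice_path w" and "crossing d (segment r)"
proof -
  obtain p q where pq: "d = {p, q}" "p < q" "1 \<le> p" "q \<le> a + b"
    using assms(2) side_or_diagonalE[OF _ three_points] by blast
  have "q \<noteq> Suc p"
    using assms(2) pq three_points by (auto simp: diagonal_iff)
  consider (red) "q \<le> a" | (blue) "a < p" | (bichromatic) "p \<le> a" "a < q" by linarith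
  then show thesis
  proof cases
    case red
    with pq \<open>q \<noteq> Suc p\<close> show thesis
      using red_segment_crosses_lattice_path[OF assms(1), of p q] that by auto
  next
    case blue
    with pq \<open>q \<noteq> Suc p\<close> show thesis
      using blue_segment_crosses_lattice_path[OF assms(1), of p q] that by auto
  next
    case bichromatic
    define r where "r = (a - p, q - Suc a)"
    have d: "d = segment r"
      using bichromatic_eq_segment[OF bichromatic] pq(1) by (simp add: r_def)
    have r: "fst r < a" "snd r < b"
      using pq bichromatic by (auto simp: r_def)
    have "d \<notin> edges (a + b) (path_triangulation w)"
      using assms(2) by (auto simp: edges_def diagonals_def)
    then have "r \<notin> lattice_path w"
      using segment_in_edges_iff[OF assms(1) r] d by simp
    then obtain s where "s \<in> lattice_path w" "\<not> (r \<le> s \<or> s \<le> r)"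
      using incomparable_on_lattice_pathE[OF assms(1)] r le_corner_iff by metis
    then show thesis
      using that crossing_segment_iff r(1) in_lattice_path_bounds[OF assms(1)] d by metis
  qed
qed

lemma triangulation_path_triangulation:
  assumes "w \<in> words"
  shows "triangulation (a + b) (path_triangulation w)"
proof -
  have "\<exists>e\<in>path_triangulation w. crossing d e"
    if d: "d \<in> diagonals (a + b) - path_triangulation w" for d
  proof -
    obtain r where r: "r \<in> lattice_path w" "crossing d (segment r)"
      by (rule diagonal_crosses_lattice_path[OF assms d])
    moreover have "segment r \<notin> polygon_sides (a + b)"
      using d r(2) side_not_crossed[OF three_points] side_or_diagonalE[OF _ three_points]
      by (metis DiffD1)
    ultimately show ?thesis
      by (auto simp: path_triangulation_def)
  qed
  then show ?thesis
    unfolding triangulation_def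
    using path_triangulation_subset_diagonals path_triangulation_noncrossing assms by blast
qed

lemma colorful_path_triangulation: "colorful a b (path_triangulation w)"
proof -
  let ?E = "edges (a + b) (path_triangulation w)"
  have consecutive: "q = Suc p \<or> p = Suc q"
    if "{p, q} \<in> ?E" "p \<noteq> q" "p \<le> a \<and> q \<le> a \<or> a < p \<and> a < q" for p q
  proof -
    have "{p, q} \<noteq> segment r" for r
      using that(3) by (auto simp: segment_def doubleton_eq_iff)
    with that(1) have "{p, q} \<in> polygon_sides (a + b)"
      by (auto simp: edges_def path_triangulation_def)
    then show ?thesis
      using that(3) red_nonempty blue_nonempty
      by (auto simp: polygon_sides_def doubleton_eq_iff)
  qed
  have "\<not> t \<subseteq> {1..a} \<and> \<not> t \<subseteq> {a + 1..a + b}" if "t \<in> triangles (a + b) (path_triangulation w)" for t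
    using that
  proof (rule trianglesE)
    fix p q r assume pqr: "t = {p, q, r}" "p \<noteq> q" "q \<noteq> r" "p \<noteq> r"
      "{p, q} \<in> ?E" "{q, r} \<in> ?E" "{p, r} \<in> ?E"
    then show ?thesis
      using consecutive[of p q] consecutive[of q r] consecutive[of p r] by auto
  qed
  then show ?thesis
    unfolding colorful_def red_points_def blue_points_def by blast
qed

lemma colorful_triangulation_bichromatic:
  assumes "triangulation (a + b) T" and "colorful a b T" and "{p, q} \<in> T" and "p < q"
  shows "p \<le> a" and "a < q"
proof -
  obtain k where k: "p < k" "k < q" "{p, q, k} \<in> triangles (a + b) T"
    using triangulation_triangle_between[OF assms(1) three_points assms(3,4)] by blast
  moreover have "1 \<le> p" "q \<le> a + b"
    using assms three_points by (auto simp: triangulation_def diagonal_iff)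
  moreover have "\<not> {p, q, k} \<subseteq> {1..a}" "\<not> {p, q, k} \<subseteq> {a + 1..a + b}"
    using k(3) assms(2) unfolding colorful_def red_points_def blue_points_def by blast+
  ultimately show "p \<le> a" "a < q"
    by auto
qed

lemma colorful_triangulation_is_path_triangulation:
  assumes T: "triangulation (a + b) T" and colorful: "colorful a b T"
  shows "T \<in> path_triangulation ` words"
proof -
  define K where "K = {p. fst p < a \<and> snd p < b \<and> segment p \<in> T}"
  have "Complete_Partial_Order.chain (\<le>) K"
    using T crossing_segment_iff unfolding chain_def triangulation_def K_def by blast
  moreover have "K \<subseteq> {..(a - 1, b - 1)}"
    unfolding K_def using le_corner_iff by blast
  ultimately obtain w where w: "w \<in> words" "K \<subseteq> lattice_path w"
    using chain_subset_lattice_path by blast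
  have "T \<subseteq> path_triangulation w"
  proof
    fix d assume d: "d \<in> T"
    then have "d \<in> diagonals (a + b)"
      using T unfolding triangulation_def by blast
    then obtain p q where pq: "d = {p, q}" "p < q" "1 \<le> p" "q \<le> a + b"
      using side_or_diagonalE[OF _ three_points] by blast
    have bichromatic: "p \<le> a" "a < q"
      using colorful_triangulation_bichromatic[OF T colorful] d pq by auto
    then have "d = segment (a - p, q - Suc a)"
      using bichromatic_eq_segment pq(1) by simp
    moreover from this have "(a - p, q - Suc a) \<in> lattice_path w"
      using w(2) d pq bichromatic by (auto simp: K_def)
    ultimately show "d \<in> path_triangulation w"
      using \<open>d \<in> diagonals (a + b)\<close> by (auto simp: path_triangulation_def diagonals_def)
  qed
  then show ?thesis
    using triangulation_subset_imp_eq[OF T triangulation_path_triangulation] w(1) by blast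
qed

lemma bij_betw_path_triangulation:
  "bij_betw path_triangulation words {T. triangulation (a + b) T \<and> colorful a b T}"
  unfolding bij_betw_def
  using inj_on_path_triangulation triangulation_path_triangulation colorful_path_triangulation
    colorful_triangulation_is_path_triangulation by blast


section \<open>Flips as adjacent transpositions\<close>

text \<open>
  Both paths have exactly one point on each antidiagonal \<open>x + y = i\<close>, so the exchanged segments
  lie on the same antidiagonal.
\<close>

lemma adj_if_flip:
  assumes v: "v \<in> words" and w: "w \<in> words"
    and flip: "flip (a + b) (path_triangulation v) (path_triangulation w)"
  shows "adj v w"
proof -
  have len: "length v = length w"
    using v w by (simp add: length_combinations)
  obtain e f where e: "e \<in> path_triangulation v" "e \<noteq> f"
    and exchange: "path_triangulation w = path_triangulation v - {e} \<union> {f}"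
    by (rule flipE[OF flip])
  obtain i where i: "i \<le> length v" "e = segment (lattice_point v i)"
    using e(1) by (auto simp: path_triangulation_def lattice_path_def)
  show ?thesis
  proof (rule adj_if_lattice_point_differ_once[OF len])
    have "e \<notin> edges (a + b) (path_triangulation w)"
      using exchange e by (auto simp: edges_def path_triangulation_def)
    then show "lattice_point w i \<noteq> lattice_point v i"
      using i len lattice_point_segment_in_edges[OF w, of i] by auto
  next
    fix j assume "j \<noteq> i"
    show "lattice_point w j = lattice_point v j"
    proof (cases "j \<le> length v")
      case True
      note bounds = in_lattice_path_bounds[OF v lattice_point_in_lattice_path]
      have "lattice_point v j \<noteq> lattice_point v i"
        using \<open>j \<noteq> i\<close> True i(1) lattice_point_level by metis
      then have "segment (lattice_point v j) \<noteq> e"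
        using i bounds(1) True by (simp add: segment_eq_iff)
      then have "segment (lattice_point v j) \<in> edges (a + b) (path_triangulation w)"
        using lattice_point_segment_in_edges[OF v True] unfolding edges_def exchange by blast
      then show ?thesis
        using segment_in_edges_iff[OF w bounds[OF True]] lattice_point_eq_if_in_lattice_path True
        by blast
    qed (use v w len lattice_point_end in simp)
  qed
qed

lemma flip_grid_square:
  assumes "Suc x < a" and "Suc y < b"
    and "segment (x, y) \<in> edges (a + b) T" and "segment (Suc x, Suc y) \<in> edges (a + b) T"
    and "{p, q} = {(Suc x, y), (x, Suc y)}" and "segment p \<in> T"
  shows "flip (a + b) T (T - {segment p} \<union> {segment q})"
proof -
  have sides: "{a - Suc x, a - x} \<in> edges (a + b) T"
    "{Suc (a + y), Suc (a + Suc y)} \<in> edges (a + b) T"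
    using assms(1,2) three_points by (auto simp: edges_def side_iff)
  consider "p = (Suc x, y)" "q = (x, Suc y)" | "p = (x, Suc y)" "q = (Suc x, y)"
    using assms(5) by (auto simp: doubleton_eq_iff)
  then show ?thesis
    unfolding segment_def
    by cases (rule flipI; use assms(1,3,4,6) sides in \<open>auto simp: segment_def insert_commute\<close>)+
qed

lemma flip_if_adj:
  assumes v: "v \<in> words" and w: "w \<in> words" and adj: "adj v w"
  shows "flip (a + b) (path_triangulation v) (path_triangulation w)"
proof -
  have len: "length v = length w"
    using v w by (simp add: length_combinations)
  obtain i x y where i: "Suc (Suc i) \<le> length v"
    and xy: "lattice_point v i = (x, y)" "lattice_point v (Suc (Suc i)) = (Suc x, Suc y)"
    and pq: "{lattice_point v (Suc i), lattice_point w (Suc i)} = {(Suc x, y), (x, Suc y)}"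
    and upd: "lattice_point w = (lattice_point v)(Suc i := lattice_point w (Suc i))"
    by (rule adj_lattice_pointE[OF adj])
  let ?p = "lattice_point v (Suc i)" and ?q = "lattice_point w (Suc i)"
  have bounds: "Suc x < a" "Suc y < b"
    using in_lattice_path_bounds[OF v lattice_point_in_lattice_path[OF i]] xy(2) by auto
  have no_side: "segment r \<notin> polygon_sides (a + b)" if "r \<in> {?p, ?q}" for r
    using that bounds unfolding pq by (auto simp: segment_side_iff)
  have "path_triangulation w = path_triangulation v - {segment ?p} \<union> {segment ?q}"
    using i no_side by (intro path_triangulation_exchange[OF v len _ upd]) auto
  moreover have "segment (x, y) \<in> edges (a + b) (path_triangulation v)"
    "segment (Suc x, Suc y) \<in> edges (a + b) (path_triangulation v)"
    using lattice_point_segment_in_edges[OF v] i xy by (metis Suc_leD)+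
  moreover have "segment ?p \<in> path_triangulation v"
    using no_side lattice_point_in_lattice_path[of "Suc i" v] i
    by (auto simp: path_triangulation_def)
  ultimately show ?thesis
    using flip_grid_square[OF bounds _ _ pq] by simp
qed

end


section \<open>Isomorphisms and Hamilton paths of digraphs\<close>

lemma digraph_iso_with_proj:
  assumes "bij_betw f (pverts G) (pverts H)" and "parcs G \<subseteq> pverts G \<times> pverts G"
    and "parcs H = map_prod f f ` parcs G"
  shows "digraph_iso (with_proj G) (with_proj H)"
proof -
  let ?f = "\<lparr>iso_verts = f, iso_arcs = map_prod f f, iso_head = snd, iso_tail = fst\<rparr>"
  have inj: "inj_on f (pverts G)" and image: "f ` pverts G = pverts H"
    using assms(1) by (auto simp: bij_betw_def)
  have "wf_digraph (with_proj G)"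
    by unfold_locales (use assms(2) in auto)
  moreover have "inj_on (map_prod f f) (parcs G)"
    using map_prod_inj_on[OF inj inj] assms(2) by (rule inj_on_subset)
  ultimately have "pre_digraph.digraph_isomorphism (with_proj G) ?f"
    using inj by (simp add: pre_digraph.digraph_isomorphism_def)
  moreover have "with_proj H = app_iso ?f (with_proj G)"
    by (rule pre_digraph.equality) (simp_all add: image assms(3))
  ultimately show ?thesis
    unfolding digraph_iso_def by blast
qed

lemma vpath_app_iso:
  assumes "wf_digraph G" and "pre_digraph.digraph_isomorphism G h" and "vpath p G"
  shows "vpath (map (iso_verts h) p) (app_iso h G)"
proof -
  have "inj_on (iso_verts h) (set p)"
    using pre_digraph.digraph_isomorphism_inj_on_verts[OF assms(2)] assms(3)
    by (auto simp: vpath_def vwalk_def intro: inj_on_subset)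
  moreover have "vwalk_arcs (map (iso_verts h) p) =
      map (\<lambda>(u, v). (iso_verts h u, iso_verts h v)) (vwalk_arcs p)"
    by (induction p rule: vwalk_arcs.induct) auto
  ultimately show ?thesis
    using assms(3) wf_digraph.arcs_ends_app_iso_eq[OF assms(1,2)]
    by (auto simp: vpath_def vwalk_def distinct_map)
qed

lemma digraph_iso_imp_has_hamilton_path:
  assumes "wf_digraph G" and "digraph_iso G H" and "has_hamilton_path G"
  shows "has_hamilton_path H"
proof -
  obtain h where "pre_digraph.digraph_isomorphism G h" "H = app_iso h G"
    using assms(2) unfolding digraph_iso_def by blast
  moreover obtain p where "vpath p G" "set p = verts G"
    using assms(3) unfolding has_hamilton_path_def by blast
  ultimately show ?thesis
    unfolding has_hamilton_path_def using vpath_app_iso[OF assms(1)]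
    by (intro exI[of _ "map (iso_verts h) p"]) simp
qed

lemma digraph_iso_imp_has_hamilton_cycle:
  assumes "wf_digraph G" and "digraph_iso G H" and "has_hamilton_cycle G"
  shows "has_hamilton_cycle H"
proof -
  obtain h where h: "pre_digraph.digraph_isomorphism G h" "H = app_iso h G"
    using assms(2) unfolding digraph_iso_def by blast
  obtain p where p: "vpath p G" "set p = verts G" "3 \<le> length p" "(last p, hd p) \<in> arcs_ends G"
    using assms(3) unfolding has_hamilton_cycle_def by blast
  then have "p \<noteq> []" by auto
  then have "(last (map (iso_verts h) p), hd (map (iso_verts h) p)) \<in> arcs_ends H"
    using p(4) h wf_digraph.arcs_ends_app_iso_eq[OF assms(1) h(1)]
    by (auto simp: last_map hd_map)
  then show ?thesis
    unfolding has_hamilton_cycle_def using vpath_app_iso[OF assms(1) h(1) p(1)] p(2,3) h(2)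
    by (intro exI[of _ "map (iso_verts h) p"]) simp
qed

lemma wf_digraph_digraph_iso:
  assumes "wf_digraph G" and "digraph_iso G H"
  shows "wf_digraph H"
proof -
  obtain h where "pre_digraph.digraph_isomorphism G h" "H = app_iso h G"
    using assms(2) unfolding digraph_iso_def by blast
  then show ?thesis
    using wf_digraph.wf_digraphI_app_iso[OF assms(1)] by simp
qed

lemma digraph_iso_has_hamilton_path_iff:
  assumes "wf_digraph G" and "digraph_iso G H"
  shows "has_hamilton_path G \<longleftrightarrow> has_hamilton_path H"
  using assms digraph_iso_imp_has_hamilton_path digraph_iso_swap wf_digraph_digraph_iso by metis

lemma digraph_iso_has_hamilton_cycle_iff:
  assumes "wf_digraph G" and "digraph_iso G H"
  shows "has_hamilton_cycle G \<longleftrightarrow> has_hamilton_cycle H"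
  using assms digraph_iso_imp_has_hamilton_cycle digraph_iso_swap wf_digraph_digraph_iso by metis

lemma ham_path_iff_vpath:
  assumes "S \<subseteq> verts G"
  shows "ham_path (\<lambda>u v. (u, v) \<in> arcs_ends G) S x y \<longleftrightarrow>
    (\<exists>p. vpath p G \<and> set p = S \<and> hd p = x \<and> last p = y)"
proof
  assume "ham_path (\<lambda>u v. (u, v) \<in> arcs_ends G) S x y"
  then show "\<exists>p. vpath p G \<and> set p = S \<and> hd p = x \<and> last p = y"
    using assms
  proof (induction rule: ham_path.induct)
    case (ham_path_singleton x)
    then show ?case
      by (intro exI[of _ "[x]"]) (auto simp: vpath_def vwalk_def)
  next
    case (ham_path_insert x x' S y)
    then obtain p where "vpath p G" "set p = S" "hd p = x'" "last p = y"
      by auto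
    then show ?case
      using ham_path_insert by (intro exI[of _ "x # p"]) (auto simp: vpath_def vwalk_def)
  qed
next
  assume "\<exists>p. vpath p G \<and> set p = S \<and> hd p = x \<and> last p = y"
  then obtain p where p: "vpath p G" "set p = S" "hd p = x" "last p = y" by blast
  have "p \<noteq> []"
    using p(1) by (auto simp: vpath_def vwalk_def)
  then have "ham_path (\<lambda>u v. (u, v) \<in> arcs_ends G) (set p) (hd p) (last p)"
    using p(1)
  proof (induction p rule: list_nonempty_induct)
    case (single x)
    show ?case by (simp add: ham_path_singleton)
  next
    case (cons x p)
    then show ?case
      by (auto simp: vpath_def vwalk_def intro!: ham_path_insert)
  qed
  then show "ham_path (\<lambda>u v. (u, v) \<in> arcs_ends G) S x y"
    using p(2-4) by simp
qed

lemma has_hamilton_path_iff_ham_path: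
  "has_hamilton_path G \<longleftrightarrow> (\<exists>x y. ham_path (\<lambda>u v. (u, v) \<in> arcs_ends G) (verts G) x y)"
  by (auto simp: has_hamilton_path_def ham_path_iff_vpath)

lemma has_hamilton_cycle_iff_ham_cycle:
  "has_hamilton_cycle G \<longleftrightarrow> ham_cycle (\<lambda>u v. (u, v) \<in> arcs_ends G) (verts G)"
proof -
  have "length p = card (verts G)" if "vpath p G" "set p = verts G" for p
    using that by (metis distinct_card vpath_def)
  then show ?thesis
    unfolding has_hamilton_cycle_def ham_cycle_def ham_path_iff_vpath[OF subset_refl] by metis
qed


section \<open>The flip graph of colorful triangulations\<close>

lemma ham_path_combination_graph:
  "ham_path (\<lambda>u v. (u, v) \<in> arcs_ends (combination_graph k l)) (combinations k l) x y \<longleftrightarrow>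
     ham_path adj (combinations k l) x y"
  using ham_path_image[of _ "combinations k l" x y id]
  by (auto simp: combination_graph_def)

lemma has_hamilton_path_combination_graph_iff:
  "has_hamilton_path (combination_graph k l) \<longleftrightarrow> k \<le> 1 \<or> l \<le> 1 \<or> (odd k \<and> odd l)"
proof -
  have "verts (combination_graph k l) = combinations k l"
    by (simp add: combination_graph_def)
  then show ?thesis
    by (simp only: has_hamilton_path_iff_ham_path ham_path_combination_graph
        ham_path_combinations_iff)
qed

lemma no_hamilton_cycle_combination_graph: "\<not> has_hamilton_cycle (combination_graph k l)"
proof
  assume "has_hamilton_cycle (combination_graph k l)"
  then have "ham_cycle (\<lambda>u v. (u, v) \<in> arcs_ends (combination_graph k l)) (combinations k l)"
    unfolding has_hamilton_cycle_iff_ham_cycle by (simp add: combination_graph_def)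
  then have "ham_cycle adj (combinations k l)"
    unfolding ham_cycle_def ham_path_combination_graph by (auto simp: combination_graph_def)
  then show False
    using no_ham_cycle_combinations by blast
qed

lemma wf_digraph_combination_graph: "wf_digraph (combination_graph k l)"
  by unfold_locales (auto simp: combination_graph_def)

lemma (in bicolored_polygon) digraph_iso_combination_graph:
  "digraph_iso (combination_graph (a - 1) (b - 1)) (colorful_flip_graph a b)"
proof -
  let ?V = "{T. triangulation (a + b) T \<and> colorful a b T}"
  let ?flips = "{(S, T). S \<in> ?V \<and> T \<in> ?V \<and> flip (a + b) S T}"
  have V: "?V = path_triangulation ` words"
    using bij_betw_path_triangulation by (simp add: bij_betw_def)
  have "?flips = map_prod path_triangulation path_triangulation `
      {(v, w). v \<in> words \<and> w \<in> words \<and> adj v w}"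
    unfolding V using adj_if_flip flip_if_adj by force
  moreover have "colorful_flip_graph a b = with_proj \<lparr>pverts = ?V, parcs = ?flips\<rparr>"
    by (rule pre_digraph.equality)
      (auto simp: colorful_flip_graph_def associahedron_def induce_subgraph_def)
  ultimately show ?thesis
    unfolding combination_graph_def using bij_betw_path_triangulation
    by (simp only:, intro digraph_iso_with_proj) auto
qed

theorem theorem3:
  fixes a b :: nat
  assumes "a \<ge> 1" and "b \<ge> 1" and "a + b \<ge> 3"
  shows "digraph_iso (colorful_flip_graph a b) (combination_graph (a - 1) (b - 1)) \<and>
    (has_hamilton_path (colorful_flip_graph a b) \<longleftrightarrow>
       a \<in> {1, 2} \<or> b \<in> {1, 2} \<or> (even a \<and> even b)) \<and>
    (a \<ge> 2 \<and> b \<ge> 2 \<longrightarrow> \<not> has_hamilton_cycle (colorful_flip_graph a b))"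
proof -
  let ?F = "colorful_flip_graph a b" and ?H = "combination_graph (a - 1) (b - 1)"
  interpret bicolored_polygon a b
    by unfold_locales (fact assms)+
  have iso: "digraph_iso ?H ?F"
    by (rule digraph_iso_combination_graph)
  have "a - 1 \<le> 1 \<or> b - 1 \<le> 1 \<or> (odd (a - 1) \<and> odd (b - 1)) \<longleftrightarrow>
      a \<in> {1, 2} \<or> b \<in> {1, 2} \<or> (even a \<and> even b)"
    using assms(1,2) by auto
  then have "has_hamilton_path ?F \<longleftrightarrow> a \<in> {1, 2} \<or> b \<in> {1, 2} \<or> (even a \<and> even b)"
    using digraph_iso_has_hamilton_path_iff[OF wf_digraph_combination_graph iso]
      has_hamilton_path_combination_graph_iff by simp
  moreover have "\<not> has_hamilton_cycle ?F"
    using digraph_iso_has_hamilton_cycle_iff[OF wf_digraph_combination_graph iso]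
      no_hamilton_cycle_combination_graph by blast
  ultimately show ?thesis
    using digraph_iso_swap[OF wf_digraph_combination_graph iso] by blast
qed

end
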